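(* Suppose that for every cardinal $\mu$ there exists an $L_{\mu,\omega}$-compact cardinal. Then every abstract elementary class is tame.
   Context: A filter is $\kappa$-complete if it is closed under intersections of fewer than $\kappa$ of its members. A cardinal $\kappa\ge\mu$ is $L_{\mu,\omega}$-compact if any (proper) $\kappa$-complete filter on a set $I$ extends to a $\mu$-complete ultrafilter on $I$. An abstract elementary class (AEC) is a pair $(\mathbf{K},\le_{\mathbf{K}})$ where $\mathbf{K}$ is a class of structures in a fixed finitary signature $\Sigma$ and $\le_{\mathbf{K}}$ is a partial order on $\mathbf{K}$ such that: (1) $M\le_{\mathbf{K}}N$ implies $M$ is a substructure of $N$; (2) $\mathbf{K}$ and $\le_{\mathbf{K}}$ are closed under isomorphism; (3) (coherence) if $M_0\le_{\mathbf{K}}M_2$, $M_1\le_{\mathbf{K}}M_2$ and $M_0$ is a substructure of $M_1$, then $M_0\le_{\mathbf{K}}M_1$; (4) (Tarski--Vaught chain axioms) if $(M_i)_{i<\delta}$ is a $\le_{\mathbf{K}}$-increasing chain, with $\delta$ a limit ordinal, then $M=\bigcup_{i<\delta}M_i\in\mathbf{K}$, $M_i\le_{\mathbf{K}}M$ for all $i<\delta$, and if $M_i\le_{\mathbf{K}}N$ for all $i<\delta$ then $M\le_{\mathbf{K}}N$; (5) (L\"owenheim--Skolem) there is an infinite cardinal $\mathrm{LS}(\mathbf{K})\ge|\Sigma|$ such that for every $M\in\mathbf{K}$ and every subset $A\subseteq M$ there is $N\le_{\mathbf{K}}M$ with $A\subseteq N$ and $|N|\le|A|+\mathrm{LS}(\mathbf{K})$.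 A $\mathbf{K}$-embedding $f\colon M\to N$ is an isomorphism of $M$ onto a substructure $f(M)$ of $N$ with $f(M)\le_{\mathbf{K}}N$. Consider triples $(a,M,N)$ with $M\le_{\mathbf{K}}N$ and $a\in N$. Two triples $(a_1,M,N_1)$, $(a_2,M,N_2)$ over the same $M$ are atomically equivalent if there are $N\in\mathbf{K}$ and $\mathbf{K}$-embeddings $f_i\colon N_i\to N$ ($i=1,2$) that agree on $M$ and satisfy $f_1(a_1)=f_2(a_2)$. Galois types over $M$ are the equivalence classes of such triples under the transitive closure of atomic equivalence. For $M_0\le_{\mathbf{K}}M$, the restriction to $M_0$ of the type of $(a,M,N)$ is the type of $(a,M_0,N)$. The AEC is tame if there is a cardinal $\kappa\ge\mathrm{LS}(\mathbf{K})$ such that for every $M\in\mathbf{K}$ and all Galois types $p,q$ over $M$: if $p$ and $q$ have the same restriction to every $M_0\le_{\mathbf{K}}M$ with $|M_0|\le\kappa$, then $p=q$. *)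

theory Defs
  imports Main
begin

unbundle cardinal_syntax

section \<open>The universe of sets\<close>

text \<open>
  An abstract elementary class is a proper class of set-sized structures, and the large-cardinal
  hypothesis speaks about all cardinals. HOL itself has no universe of sets, so everything below
  takes place in a type whose elements are the sets of ZFC: \<open>elts x\<close> is the collection of members
  of \<open>x\<close>. Collections \<open>'v set\<close> are the classes of this universe, and a class is a set when it is
  \<open>small\<close>. Replacement is stated for class functions, i.e. for HOL functions; the axiom of choice is
  inherited from HOL.

  As every HOL function between small collections is itself a set of the universe, HOL's
  comparisons of cardinalities of small collections agree with those made inside the universe.
\<close>

class zfc_universe =
  fixes elts :: "'a \<Rightarrow> 'a set"
  assumes extensionality: "elts x = elts y \<Longrightarrow> x = y"
    and foundation: "wf {(x, y). x \<in> elts y}"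
    and separation: "\<exists>y. elts y = {z \<in> elts x. P z}"
    and pairing: "\<exists>z. elts z = {x, y}"
    and union: "\<exists>y. elts y = (\<Union>z\<in>elts x. elts z)"
    and powerset: "\<exists>y. elts y = {z. elts z \<subseteq> elts x}"
    and replacement: "\<exists>y. elts y = f ` elts x"
    and infinity: "\<exists>w. (\<exists>e\<in>elts w. elts e = {}) \<and>
      (\<forall>x\<in>elts w. \<exists>y\<in>elts w. elts y = insert x (elts x))"

definition small :: "'v::zfc_universe set \<Rightarrow> bool" where
  "small A \<longleftrightarrow> (\<exists>x. elts x = A)"

text \<open>
  Cardinals of the universe are represented, up to isomorphism \<open>=o\<close>, by HOL's cardinal orders on
  sets of the universe. They may be finite.
\<close>

definition cardinal :: "'v::zfc_universe rel \<Rightarrow> bool" where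
  "cardinal \<kappa> \<longleftrightarrow> Card_order \<kappa> \<and> small (Field \<kappa>)"


section \<open>Compact cardinals\<close>

text \<open>
  A filter on a set \<open>I\<close> is a filter \<open>F \<le> principal I\<close>; it is proper if \<open>F \<noteq> bot\<close>. A collection
  \<open>A\<close> belongs to \<open>F\<close> if \<open>eventually (\<lambda>x. x \<in> A) F\<close>, and a filter \<open>U\<close> extends \<open>F\<close> (has more
  members) if \<open>U \<le> F\<close>.
\<close>

definition complete_filter :: "'v rel \<Rightarrow> 'v filter \<Rightarrow> bool" where
  "complete_filter \<kappa> F \<longleftrightarrow>
    (\<forall>S :: 'v set set. |S| <o \<kappa> \<longrightarrow> (\<forall>A\<in>S. eventually (\<lambda>x. x \<in> A) F)
       \<longrightarrow> eventually (\<lambda>x. x \<in> \<Inter>S) F)"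

definition ultrafilter :: "'v filter \<Rightarrow> bool" where
  "ultrafilter U \<longleftrightarrow> U \<noteq> bot \<and>
    (\<forall>A. eventually (\<lambda>x. x \<in> A) U \<or> eventually (\<lambda>x. x \<notin> A) U)"

definition L_compact :: "'v::zfc_universe rel \<Rightarrow> 'v rel \<Rightarrow> bool" where
  "L_compact \<mu> \<kappa> \<longleftrightarrow> cardinal \<mu> \<and> cardinal \<kappa> \<and> \<mu> \<le>o \<kappa> \<and>
    (\<forall>I F. small I \<longrightarrow> F \<le> principal I \<longrightarrow> F \<noteq> bot \<longrightarrow> complete_filter \<kappa> F \<longrightarrow>
       (\<exists>U\<le>F. ultrafilter U \<and> complete_filter \<mu> U))"


section \<open>Structures\<close>

record 'v signature =
  fsyms :: "'v set"
  rsyms :: "'v set"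
  farity :: "'v \<Rightarrow> nat"
  rarity :: "'v \<Rightarrow> nat"

definition signature :: "'v::zfc_universe signature \<Rightarrow> bool" where
  "signature Sig \<longleftrightarrow> small (fsyms Sig) \<and> small (rsyms Sig)"

definition tuples :: "nat \<Rightarrow> 'v set \<Rightarrow> 'v list set" where
  "tuples n A = {xs. length xs = n \<and> set xs \<subseteq> A}"

record 'v struct =
  univ :: "'v set"
  fint :: "'v \<Rightarrow> 'v list \<Rightarrow> 'v"
  rint :: "'v \<Rightarrow> 'v list set"

text \<open>
  The last two conditions fix the junk values of the interpretations, so that equality of records is
  equality of structures (needed for antisymmetry). The empty structure is not excluded.
\<close>

definition struct_on :: "'v::zfc_universe signature \<Rightarrow> 'v struct \<Rightarrow> bool" where
  "struct_on Sig M \<longleftrightarrow> small (univ M) \<and>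
    (\<forall>f\<in>fsyms Sig. \<forall>xs\<in>tuples (farity Sig f) (univ M). fint M f xs \<in> univ M) \<and>
    (\<forall>R\<in>rsyms Sig. rint M R \<subseteq> tuples (rarity Sig R) (univ M)) \<and>
    (\<forall>f xs. \<not> (f \<in> fsyms Sig \<and> xs \<in> tuples (farity Sig f) (univ M)) \<longrightarrow>
       fint M f xs = undefined) \<and>
    (\<forall>R. R \<notin> rsyms Sig \<longrightarrow> rint M R = {})"

definition substruct :: "'v::zfc_universe signature \<Rightarrow> 'v struct \<Rightarrow> 'v struct \<Rightarrow> bool" where
  "substruct Sig M N \<longleftrightarrow> struct_on Sig M \<and> struct_on Sig N \<and> univ M \<subseteq> univ N \<and>
    (\<forall>f\<in>fsyms Sig. \<forall>xs\<in>tuples (farity Sig f) (univ M). fint M f xs = fint N f xs) \<and>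
    (\<forall>R\<in>rsyms Sig. rint M R = rint N R \<inter> tuples (rarity Sig R) (univ M))"

definition struct_iso ::
    "'v::zfc_universe signature \<Rightarrow> ('v \<Rightarrow> 'v) \<Rightarrow> 'v struct \<Rightarrow> 'v struct \<Rightarrow> bool" where
  "struct_iso Sig h M N \<longleftrightarrow> struct_on Sig M \<and> struct_on Sig N \<and> bij_betw h (univ M) (univ N) \<and>
    (\<forall>f\<in>fsyms Sig. \<forall>xs\<in>tuples (farity Sig f) (univ M).
       h (fint M f xs) = fint N f (map h xs)) \<and>
    (\<forall>R\<in>rsyms Sig. \<forall>xs\<in>tuples (rarity Sig R) (univ M).
       xs \<in> rint M R \<longleftrightarrow> map h xs \<in> rint N R)"

text \<open>The union of a chain of substructures, indexed by the nonempty collection \<open>I\<close>.\<close>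

definition union_struct ::
    "'v::zfc_universe signature \<Rightarrow> 'v set \<Rightarrow> ('v \<Rightarrow> 'v struct) \<Rightarrow> 'v struct" where
  "union_struct Sig I Ms =
    \<lparr>univ = (\<Union>i\<in>I. univ (Ms i)),
     fint = (\<lambda>f xs. if f \<in> fsyms Sig \<and> xs \<in> tuples (farity Sig f) (\<Union>i\<in>I. univ (Ms i))
               then THE y. \<exists>i\<in>I. set xs \<subseteq> univ (Ms i) \<and> y = fint (Ms i) f xs
               else undefined),
     rint = (\<lambda>R. \<Union>i\<in>I. rint (Ms i) R)\<rparr>"


section \<open>Abstract elementary classes\<close>

text \<open>Limit ordinals (nonzero), as well-orders without a last element.\<close>

definition limit_order :: "'v::zfc_universe rel \<Rightarrow> bool" where
  "limit_order r \<longleftrightarrow> Well_order r \<and> small (Field r) \<and> Field r \<noteq> {} \<and>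
    (\<forall>i\<in>Field r. \<exists>j. j \<noteq> i \<and> (i, j) \<in> r)"

definition LS_bound ::
    "'v::zfc_universe signature \<Rightarrow> 'v struct set \<Rightarrow> 'v struct rel \<Rightarrow> 'v rel \<Rightarrow> bool" where
  "LS_bound Sig K le \<theta> \<longleftrightarrow> cardinal \<theta> \<and> infinite (Field \<theta>) \<and>
    |fsyms Sig <+> rsyms Sig| \<le>o \<theta> \<and>
    (\<forall>M\<in>K. \<forall>A\<subseteq>univ M. \<exists>N. (N, M) \<in> le \<and> A \<subseteq> univ N \<and> |univ N| \<le>o |A| +c \<theta>)"

text \<open>The pair \<open>(M, N) \<in> le\<close> stands for \<open>M\<close> being a strong substructure of \<open>N\<close>.\<close>

definition AEC ::
    "'v::zfc_universe signature \<Rightarrow> 'v struct set \<Rightarrow> 'v struct rel \<Rightarrow> bool" where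
  "AEC Sig K le \<longleftrightarrow>
    signature Sig \<and> (\<forall>M\<in>K. struct_on Sig M) \<and> partial_order_on K le \<and>
    (\<forall>M N. (M, N) \<in> le \<longrightarrow> substruct Sig M N) \<and>
    (\<forall>M N h. M \<in> K \<longrightarrow> struct_iso Sig h M N \<longrightarrow> N \<in> K) \<and>
    (\<forall>M N M' N' h. (M, N) \<in> le \<longrightarrow> struct_iso Sig h N N' \<longrightarrow> struct_iso Sig h M M' \<longrightarrow>
       (M', N') \<in> le) \<and>
    (\<forall>M0 M1 M2. (M0, M2) \<in> le \<longrightarrow> (M1, M2) \<in> le \<longrightarrow> substruct Sig M0 M1 \<longrightarrow> (M0, M1) \<in> le) \<and>
    (\<forall>r Ms. limit_order r \<longrightarrow> (\<forall>i j. (i, j) \<in> r \<longrightarrow> (Ms i, Ms j) \<in> le) \<longrightarrow>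
       union_struct Sig (Field r) Ms \<in> K \<and>
       (\<forall>i\<in>Field r. (Ms i, union_struct Sig (Field r) Ms) \<in> le) \<and>
       (\<forall>N. (\<forall>i\<in>Field r. (Ms i, N) \<in> le) \<longrightarrow> (union_struct Sig (Field r) Ms, N) \<in> le)) \<and>
    (\<exists>\<theta>. LS_bound Sig K le \<theta>)"

text \<open>
  The number \<open>LS(K)\<close> is the least cardinal with the Loewenheim--Skolem property; it is determined
  up to \<open>=o\<close>.
\<close>

definition LS ::
    "'v::zfc_universe signature \<Rightarrow> 'v struct set \<Rightarrow> 'v struct rel \<Rightarrow> 'v rel" where
  "LS Sig K le =
    (SOME \<theta>. LS_bound Sig K le \<theta> \<and> (\<forall>\<theta>'. LS_bound Sig K le \<theta>' \<longrightarrow> \<theta> \<le>o \<theta>'))"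

definition K_embedding ::
    "'v::zfc_universe signature \<Rightarrow> 'v struct rel \<Rightarrow> ('v \<Rightarrow> 'v) \<Rightarrow> 'v struct \<Rightarrow> 'v struct \<Rightarrow> bool" where
  "K_embedding Sig le f M N \<longleftrightarrow> (\<exists>M'. struct_iso Sig f M M' \<and> substruct Sig M' N \<and> (M', N) \<in> le)"


section \<open>Galois types and tameness\<close>

type_synonym 'v triple = "'v \<times> 'v struct \<times> 'v struct"

definition triples_over :: "'v struct rel \<Rightarrow> 'v struct \<Rightarrow> 'v triple set" where
  "triples_over le M = {(a, M', N). M' = M \<and> (M, N) \<in> le \<and> a \<in> univ N}"

definition atomic_equiv ::
    "'v::zfc_universe signature \<Rightarrow> 'v struct set \<Rightarrow> 'v struct rel \<Rightarrow> 'v struct \<Rightarrow> 'v triple rel" where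
  "atomic_equiv Sig K le M =
    {((a1, M1, N1), (a2, M2, N2)).
       (a1, M1, N1) \<in> triples_over le M \<and> (a2, M2, N2) \<in> triples_over le M \<and>
       (\<exists>N\<in>K. \<exists>f1 f2. K_embedding Sig le f1 N1 N \<and> K_embedding Sig le f2 N2 N \<and>
          (\<forall>x\<in>univ M. f1 x = f2 x) \<and> f1 a1 = f2 a2)}"

definition galois_types ::
    "'v::zfc_universe signature \<Rightarrow> 'v struct set \<Rightarrow> 'v struct rel \<Rightarrow> 'v struct \<Rightarrow> 'v triple set set" where
  "galois_types Sig K le M = triples_over le M // (atomic_equiv Sig K le M)\<^sup>+"

definition galois_type ::
    "'v::zfc_universe signature \<Rightarrow> 'v struct set \<Rightarrow> 'v struct rel \<Rightarrow>
     'v \<Rightarrow> 'v struct \<Rightarrow> 'v struct \<Rightarrow> 'v triple set" where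
  "galois_type Sig K le a M N = (atomic_equiv Sig K le M)\<^sup>+ `` {(a, M, N)}"

text \<open>
  The type of \<open>(a, M\<^sub>0, N)\<close> is the same for all representatives \<open>(a, M, N)\<close> of \<open>p\<close>, so the union
  below equals each of these types; see \<open>restrict_galois_type\<close>.
\<close>

definition restrict_type ::
    "'v::zfc_universe signature \<Rightarrow> 'v struct set \<Rightarrow> 'v struct rel \<Rightarrow>
     'v triple set \<Rightarrow> 'v struct \<Rightarrow> 'v triple set" where
  "restrict_type Sig K le p M0 = (\<Union>(a, M, N)\<in>p. galois_type Sig K le a M0 N)"

definition tame ::
    "'v::zfc_universe signature \<Rightarrow> 'v struct set \<Rightarrow> 'v struct rel \<Rightarrow> bool" where
  "tame Sig K le \<longleftrightarrow>
    (\<exists>\<kappa> :: 'v rel. cardinal \<kappa> \<and> LS Sig K le \<le>o \<kappa> \<and>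
      (\<forall>M\<in>K. \<forall>p\<in>galois_types Sig K le M. \<forall>q\<in>galois_types Sig K le M.
         (\<forall>M0. (M0, M) \<in> le \<longrightarrow> |univ M0| \<le>o \<kappa> \<longrightarrow>
            restrict_type Sig K le p M0 = restrict_type Sig K le q M0) \<longrightarrow> p = q))"

lemma struct_iso_id: "struct_on Sig M \<Longrightarrow> struct_iso Sig id M M"
  unfolding struct_iso_def by (intro conjI ballI) (simp_all only: list.map_id id_apply bij_betw_id)

lemma AEC_basics:
  assumes "AEC Sig K le"
  shows "partial_order_on K le" "\<forall>M\<in>K. struct_on Sig M"
    "\<forall>M N. (M, N) \<in> le \<longrightarrow> substruct Sig M N"
  using assms[unfolded AEC_def, THEN conjunct2, THEN conjunct1]
    assms[unfolded AEC_def, THEN conjunct2, THEN conjunct2, THEN conjunct1]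
    assms[unfolded AEC_def, THEN conjunct2, THEN conjunct2, THEN conjunct2, THEN conjunct1]
  by - assumption+

lemma atomic_equiv_iff:
  "((a1, M1, N1), (a2, M2, N2)) \<in> atomic_equiv Sig K le M \<longleftrightarrow>
    (a1, M1, N1) \<in> triples_over le M \<and> (a2, M2, N2) \<in> triples_over le M \<and>
    (\<exists>N\<in>K. \<exists>f1 f2. K_embedding Sig le f1 N1 N \<and> K_embedding Sig le f2 N2 N \<and>
       (\<forall>x\<in>univ M. f1 x = f2 x) \<and> f1 a1 = f2 a2)"
  by (simp only: atomic_equiv_def mem_Collect_eq prod.case)

lemma equiv_atomic_equiv_trancl:
  assumes "AEC Sig K le"
  shows "equiv (triples_over le M) ((atomic_equiv Sig K le M)\<^sup>+)"
proof (rule equivI)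
  note po = AEC_basics(1)[OF assms] and st = AEC_basics(2)[OF assms, rule_format]
    and su = AEC_basics(3)[OF assms, rule_format]
  have "atomic_equiv Sig K le M \<subseteq> triples_over le M \<times> triples_over le M"
    unfolding atomic_equiv_def by fast
  then show "(atomic_equiv Sig K le M)\<^sup>+ \<subseteq> triples_over le M \<times> triples_over le M"
    by (rule trancl_subset_Sigma)
  show "refl_on (triples_over le M) ((atomic_equiv Sig K le M)\<^sup>+)"
  proof (rule refl_onI, rule r_into_trancl)
    fix t assume t: "t \<in> triples_over le M"
    then obtain a N where tN: "t = (a, M, N)" and "(M, N) \<in> le"
      by (auto simp: triples_over_def)
    then have N: "N \<in> K" "(N, N) \<in> le"
      using po by (auto simp: partial_order_on_def preorder_on_def refl_on_def)
    then have "K_embedding Sig le id N N"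
      unfolding K_embedding_def using struct_iso_id[OF st] su by blast
    then show "(t, t) \<in> atomic_equiv Sig K le M"
      using t N unfolding tN atomic_equiv_iff by blast
  qed
  have "sym (atomic_equiv Sig K le M)"
  proof (rule symI)
    fix s t assume A: "(s, t) \<in> atomic_equiv Sig K le M"
    obtain a1 M1 N1 where s: "s = (a1, M1, N1)" by (rule prod_cases3)
    obtain a2 M2 N2 where t: "t = (a2, M2, N2)" by (rule prod_cases3)
    obtain N f1 f2 where *: "N \<in> K" "K_embedding Sig le f1 N1 N" "K_embedding Sig le f2 N2 N"
      "\<forall>x\<in>univ M. f1 x = f2 x" "f1 a1 = f2 a2"
      using A unfolding s t atomic_equiv_iff by blast
    moreover have "\<forall>x\<in>univ M. f2 x = f1 x" "f2 a2 = f1 a1"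
      using * by simp_all
    moreover have "(a1, M1, N1) \<in> triples_over le M" "(a2, M2, N2) \<in> triples_over le M"
      using A unfolding s t atomic_equiv_iff by blast+
    ultimately show "(t, s) \<in> atomic_equiv Sig K le M"
      unfolding s t atomic_equiv_iff by blast
  qed
  then show "sym ((atomic_equiv Sig K le M)\<^sup>+)" by (rule sym_trancl)
  show "trans ((atomic_equiv Sig K le M)\<^sup>+)" by (rule trans_trancl)
qed

lemma restrict_galois_type:
  assumes K: "AEC Sig K le" and M0: "(M0, M) \<in> le" and N: "(M, N) \<in> le" "a \<in> univ N"
  shows "restrict_type Sig K le (galois_type Sig K le a M N) M0 = galois_type Sig K le a M0 N"
proof -
  note po = AEC_basics(1)[OF K]
  have sub: "univ M0 \<subseteq> univ M"
    using AEC_basics(3)[OF K, rule_format, OF M0] by (simp add: substruct_def)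
  have tr: "(M0, N') \<in> le" if "(M, N') \<in> le" for N'
    using po M0 that by (auto simp: partial_order_on_def preorder_on_def dest: transD)
  let ?g = "\<lambda>(a, M, N). (a, M0, N)"
  have atom: "(?g s, ?g t) \<in> atomic_equiv Sig K le M0" if st: "(s, t) \<in> atomic_equiv Sig K le M" for s t
  proof -
    obtain a1 M1 N1 where s: "s = (a1, M1, N1)" by (rule prod_cases3)
    obtain a2 M2 N2 where t: "t = (a2, M2, N2)" by (rule prod_cases3)
    obtain N f1 f2 where rest: "N \<in> K" "K_embedding Sig le f1 N1 N" "K_embedding Sig le f2 N2 N"
      "\<forall>x\<in>univ M. f1 x = f2 x" "f1 a1 = f2 a2"
      using st unfolding s t atomic_equiv_iff by blast
    have "(a1, M1, N1) \<in> triples_over le M" "(a2, M2, N2) \<in> triples_over le M"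
      using st unfolding s t atomic_equiv_iff by blast+
    then have "(a1, M0, N1) \<in> triples_over le M0" "(a2, M0, N2) \<in> triples_over le M0"
      using tr by (auto simp: triples_over_def)
    moreover have "\<forall>x\<in>univ M0. f1 x = f2 x"
      using rest sub by blast
    ultimately show ?thesis
      using rest unfolding s t prod.case atomic_equiv_iff by blast
  qed
  have tc: "(?g s, ?g t) \<in> (atomic_equiv Sig K le M0)\<^sup>+" if "(s, t) \<in> (atomic_equiv Sig K le M)\<^sup>+" for s t
    using that
  proof (induction rule: trancl_induct)
    case (base t)
    then show ?case by (rule r_into_trancl[OF atom])
  next
    case (step t u)
    show ?case by (rule trancl_into_trancl[OF step.IH atom[OF step.hyps(2)]])
  qed
  have in_type: "(a, M, N) \<in> galois_type Sig K le a M N"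
    using equiv_class_self[OF equiv_atomic_equiv_trancl[OF K], of "(a, M, N)"] N
    by (simp add: galois_type_def triples_over_def)
  have same: "galois_type Sig K le b M0 N' = galois_type Sig K le a M0 N"
    if "(b, M', N') \<in> galois_type Sig K le a M N" for b M' N'
  proof -
    have "((a, M0, N), (b, M0, N')) \<in> (atomic_equiv Sig K le M0)\<^sup>+"
      using tc[of "(a, M, N)" "(b, M', N')"] that by (simp add: galois_type_def)
    then show ?thesis
      unfolding galois_type_def
      by (rule equiv_class_eq[OF equiv_atomic_equiv_trancl[OF K], symmetric])
  qed
  show ?thesis
  proof
    show "restrict_type Sig K le (galois_type Sig K le a M N) M0 \<subseteq> galois_type Sig K le a M0 N"
      unfolding restrict_type_def using same by blast
    show "galois_type Sig K le a M0 N \<subseteq> restrict_type Sig K le (galois_type Sig K le a M N) M0"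
      unfolding restrict_type_def using in_type by blast
  qed
qed

end

theory Submission
  imports Defs
begin

text \<open>
  The proof is the ultraproduct argument for tameness, with a version of Los's theorem for abstract
  elementary classes that avoids both Shelah's presentation theorem and infinitary logic.

  Let \<open>U\<close> be an ultrafilter that is complete for families of size \<open>LS(K)\<close>. If the structures
  \<open>A i \<le>\<^sub>K C i\<close> have size at most \<open>LS(K)\<close>, then the atomic facts about enumerations of them are so few
  that the pair of their ultraproducts is isomorphic to the pair \<open>(A i, C i)\<close> for almost all \<open>i\<close>;
  closure of \<open>K\<close> under isomorphism does the rest (\<open>ult_small_le\<close>). An arbitrary ultraproduct of
  members of \<open>K\<close> is the directed union of the ultraproducts of small strong substructures. Abstract
  elementary classes are closed under directed unions (\<open>directed_union\<close>), so \<open>K\<close> and its strong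
  embeddings are preserved by ultraproducts (\<open>ult_directed\<close>, \<open>ult_le\<close>, \<open>ult_K_embedding\<close>), and each
  member of \<open>K\<close> is strong in its ultrapower (\<open>le_ultrapower\<close>).

  Now take a cardinal \<open>\<mu> > LS(K)\<close> and an \<open>L\<^sub>\<mu>\<^sub>,\<^sub>\<omega>\<close>-compact \<open>\<kappa>\<close>; then types are determined by their
  restrictions to structures of size at most \<open>\<kappa>\<close>. Suppose that \<open>(a\<^sub>1, M, N\<^sub>1)\<close> and \<open>(a\<^sub>2, M, N\<^sub>2)\<close>
  have the same restriction to every small \<open>M\<^sub>0 \<le>\<^sub>K M\<close>. These \<open>M\<^sub>0\<close> form an index set \<open>I\<close>, on which the
  cones \<open>{M\<^sub>0. X \<subseteq> M\<^sub>0}\<close> with \<open>X\<close> of size at most \<open>\<kappa>\<close> generate a \<open>\<kappa>\<close>-complete filter. Extend it to a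
  \<open>\<mu>\<close>-complete ultrafilter. For each index there is a finite chain of atomic equivalences over \<open>M\<^sub>0\<close>
  from \<open>(a\<^sub>1, M\<^sub>0, N\<^sub>1)\<close> to \<open>(a\<^sub>2, M\<^sub>0, N\<^sub>2)\<close>; almost all of these chains have the same length, and their
  ultraproduct is a chain from the ultrapower of \<open>N\<^sub>1\<close> to that of \<open>N\<^sub>2\<close>. Every element of \<open>M\<close> belongs to
  almost all indices, so that the embeddings in this chain agree on the diagonal copy of \<open>M\<close>
  (\<open>atomic_equiv_ult\<close>). Hence it is a chain of atomic equivalences over \<open>M\<close>, and its ends are
  atomically equivalent to the original triples.
\<close>

section \<open>Small collections\<close>

lemma small_elts [simp]: "small (elts x)"
  by (auto simp: small_def)

lemma small_subset: "small A \<Longrightarrow> B \<subseteq> A \<Longrightarrow> small B"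
proof -
  assume "small A" "B \<subseteq> A"
  then obtain a where "elts a = A"
    by (auto simp: small_def)
  moreover obtain y where "elts y = {z \<in> elts a. z \<in> B}"
    using separation[of a "\<lambda>z. z \<in> B"] by (rule exE)
  ultimately show "small B"
    using \<open>B \<subseteq> A\<close> by (auto simp: small_def intro!: exI[of _ y])
qed

lemma small_empty [simp]: "small {}"
  by (rule small_subset[OF small_elts]) simp

lemma small_image: "small A \<Longrightarrow> small (f ` A)" for f :: "'v::zfc_universe \<Rightarrow> 'v"
proof -
  assume "small A"
  then obtain a where "A = elts a"
    by (auto simp: small_def)
  then show ?thesis
    using replacement[of f a] by (simp add: small_def)
qed

lemma small_doubleton [simp]: "small {x, y}"
  unfolding small_def by (rule pairing)

lemma small_singleton [simp]: "small {x}"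
  using small_doubleton[of x x] by simp

lemma small_UN: "small A \<Longrightarrow> (\<And>x. x \<in> A \<Longrightarrow> small (F x)) \<Longrightarrow> small (\<Union>x\<in>A. F x)"
  for F :: "'v::zfc_universe \<Rightarrow> 'v set"
proof -
  assume A: "small A" and F: "\<And>x. x \<in> A \<Longrightarrow> small (F x)"
  have "\<forall>x\<in>A. \<exists>y. elts y = F x"
    using F by (auto simp: small_def)
  then obtain c where c: "\<And>x. x \<in> A \<Longrightarrow> elts (c x) = F x"
    by metis
  obtain a where a: "elts a = c ` A"
    using small_image[OF A, of c] by (auto simp: small_def)
  obtain u where "elts u = (\<Union>z\<in>elts a. elts z)"
    using union by blast
  then have "elts u = (\<Union>x\<in>A. F x)"
    using a c by auto
  then show ?thesis
    by (auto simp: small_def)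
qed

lemma small_Un: "small A \<Longrightarrow> small B \<Longrightarrow> small (A \<union> B)"
proof -
  assume "small A" "small B"
  then obtain a b where "elts a = A" "elts b = B"
    by (auto simp: small_def)
  then have "A \<union> B = (\<Union>x\<in>{a, b}. elts x)"
    by auto
  then show ?thesis
    using small_UN[of "{a, b}" elts] by (simp del: UN_insert)
qed

lemma small_insert: "small A \<Longrightarrow> small (insert x A)"
  using small_Un[of "{x}" A] by simp

lemma small_powerset: "small A \<Longrightarrow> small {z. elts z \<subseteq> A}"
  using powerset by (auto simp: small_def)

definition vset :: "'v::zfc_universe set \<Rightarrow> 'v" where
  "vset A = (THE x. elts x = A)"

lemma elts_vset [simp]: "small A \<Longrightarrow> elts (vset A) = A"
proof -
  assume "small A"
  then obtain x where x: "elts x = A"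
    by (auto simp: small_def)
  then show ?thesis
    unfolding vset_def by (intro theI[of "\<lambda>x. elts x = A" x]) (auto intro: extensionality)
qed

lemma vset_eq_iff: "small A \<Longrightarrow> small B \<Longrightarrow> vset A = vset B \<longleftrightarrow> A = B"
  by (metis elts_vset)

lemma not_mem_cycle: "x \<in> elts y \<Longrightarrow> y \<notin> elts x"
  using wf_asym[OF foundation, of x y] by auto

definition opair :: "'v::zfc_universe \<Rightarrow> 'v \<Rightarrow> 'v" where
  "opair x y = vset {vset {x, x}, vset {x, y}}"

lemma opair_eq_iff: "opair x y = opair x' y' \<longleftrightarrow> x = x' \<and> y = y'"
  unfolding opair_def by (auto simp: vset_eq_iff doubleton_eq_iff)

text \<open>
  Every HOL function restricted to a small collection is a set of the universe, and by foundation
  the code \<open>{g, b}\<close> of its graph \<open>g\<close> is not a member of \<open>b\<close>. The second ingredient will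
  keep these codes apart from the elements that represent constant functions.
\<close>

definition graph_code :: "'v::zfc_universe \<Rightarrow> 'v set \<Rightarrow> ('v \<Rightarrow> 'v) \<Rightarrow> 'v" where
  "graph_code b I g = vset {vset ((\<lambda>i. opair i (g i)) ` I), b}"

lemma graph_code_eqD:
  assumes "small I" "graph_code b I g = graph_code b I h" "i \<in> I"
  shows "g i = h i"
proof -
  have "vset ((\<lambda>i. opair i (g i)) ` I) = vset ((\<lambda>i. opair i (h i)) ` I)"
    using assms(2) by (auto simp: graph_code_def vset_eq_iff doubleton_eq_iff)
  then have "(\<lambda>i. opair i (g i)) ` I = (\<lambda>i. opair i (h i)) ` I"
    by (simp add: vset_eq_iff small_image[OF assms(1)])
  then have "opair i (g i) \<in> (\<lambda>i. opair i (h i)) ` I"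
    using assms(3) by blast
  then show ?thesis
    by (auto simp: opair_eq_iff)
qed

lemma graph_code_notin: "graph_code b I g \<notin> elts b"
  using not_mem_cycle[of "graph_code b I g" b] by (auto simp: graph_code_def)

lemma small_graph_codes:
  assumes "small I" "small Y"
  shows "small {graph_code b I g | g. g ` I \<subseteq> Y}"
proof -
  let ?P = "\<Union>i\<in>I. opair i ` Y"
  have "small ?P"
    using assms by (intro small_UN small_image)
  then have "small ((\<lambda>z. vset {z, b}) ` {z. elts z \<subseteq> ?P})"
    by (intro small_image small_powerset)
  moreover have "{graph_code b I g | g. g ` I \<subseteq> Y} \<subseteq> (\<lambda>z. vset {z, b}) ` {z. elts z \<subseteq> ?P}"
  proof clarify
    fix g assume "g ` I \<subseteq> Y"
    then have "elts (vset ((\<lambda>i. opair i (g i)) ` I)) \<subseteq> ?P"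
      by (auto simp: small_image[OF assms(1)])
    then show "graph_code b I g \<in> (\<lambda>z. vset {z, b}) ` {z. elts z \<subseteq> ?P}"
      unfolding graph_code_def by blast
  qed
  ultimately show ?thesis
    by (rule small_subset)
qed

text \<open>
  Classes modulo a filter of functions on a small \<open>I\<close> can be represented by elements of the
  universe; this is where choice picks a representative \<open>r g\<close> of each class. The freedom in the
  representation is spent on letting the class of each constant function with value in \<open>B\<close> be
  represented by the value: a structure with universe inside \<open>B\<close> is then literally contained in
  its ultrapower, and no isomorphic copies of ultrapowers are necessary later on.
\<close>

lemma function_classes_exist:
  fixes I B :: "'v::zfc_universe set"
  assumes I: "small I" and U: "U \<noteq> bot" "U \<le> principal I" and B: "small B"
  obtains cls :: "('v \<Rightarrow> 'v) \<Rightarrow> 'v" where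
    "\<And>g h. cls g = cls h \<longleftrightarrow> eventually (\<lambda>i. g i = h i) U"
    "\<And>X. (\<And>i. small (X i)) \<Longrightarrow> small {cls g | g. eventually (\<lambda>i. g i \<in> X i) U}"
    "\<And>x. x \<in> B \<Longrightarrow> cls (\<lambda>_. x) = x"
proof -
  define r where "r g = (SOME h. eventually (\<lambda>i. h i = g i) U)" for g :: "'v \<Rightarrow> 'v"
  define isc where "isc g x \<longleftrightarrow> x \<in> B \<and> eventually (\<lambda>i. g i = x) U" for g :: "'v \<Rightarrow> 'v" and x
  define cls where "cls g = (if \<exists>x. isc g x then THE x. isc g x else graph_code (vset B) I (r g))"
    for g
  have inI: "eventually (\<lambda>i. i \<in> I) U"
    using U(2) by (simp add: le_principal)
  have r: "eventually (\<lambda>i. r g i = g i) U" for g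
    unfolding r_def by (rule someI[of _ g]) simp
  have isc_unique: "x = y" if "isc g x" "isc g y" for g x y
  proof -
    have "eventually (\<lambda>i. x = y) U"
      using that[unfolded isc_def] by (auto elim: eventually_elim2)
    then show ?thesis
      using U(1) by simp
  qed
  have cls_const: "cls g = x" if "isc g x" for g x
  proof -
    have "(THE x. isc g x) = x"
      using that by (rule the_equality) (rule isc_unique[OF _ that])
    then show ?thesis
      using that unfolding cls_def by (metis (full_types))
  qed
  have cls_cong: "cls g = cls h" if gh: "eventually (\<lambda>i. g i = h i) U" for g h
  proof -
    have "eventually (\<lambda>i. g i = k i) U \<longleftrightarrow> eventually (\<lambda>i. h i = k i) U" for k
      using gh by (intro eventually_subst) (auto elim: eventually_mono)
    then have "isc g = isc h"
      unfolding isc_def by (intro ext) simp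
    moreover have "eventually (\<lambda>i. k i = g i) U \<longleftrightarrow> eventually (\<lambda>i. k i = h i) U" for k
      using gh by (intro eventually_subst) (auto elim: eventually_mono)
    then have "r g = r h"
      unfolding r_def by simp
    ultimately show ?thesis
      by (simp add: cls_def)
  qed
  have cls_eqD: "eventually (\<lambda>i. g i = h i) U" if eq: "cls g = cls h" for g h
  proof -
    have nc: False if "isc g x" "\<not> (\<exists>x. isc h x)" "cls g = cls h" for g h x
    proof -
      have "cls g \<in> B"
        using that(1) cls_const by (simp add: isc_def)
      moreover have "cls h \<notin> B"
        using that(2) graph_code_notin[of "vset B" I "r h"] B by (simp add: cls_def)
      ultimately show False
        using that(3) by simp
    qed
    consider x y where "isc g x" "isc h y" | "\<not> (\<exists>x. isc g x)" "\<not> (\<exists>x. isc h x)"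
      using nc[OF _ _ eq] nc[OF _ _ eq[symmetric]] by blast
    then show ?thesis
    proof cases
      case 1
      then have "x = y"
        using eq cls_const by simp
      then show ?thesis
        using 1 unfolding isc_def by (auto elim: eventually_elim2)
    next
      case 2
      then have "graph_code (vset B) I (r g) = graph_code (vset B) I (r h)"
        using eq by (simp add: cls_def)
      then have eqI: "r g i = r h i" if "i \<in> I" for i
        using graph_code_eqD[OF I] that by blast
      show ?thesis
        using inI r[of g] r[of h] by eventually_elim (simp add: eqI)
    qed
  qed
  have small_cls: "small {cls g | g. eventually (\<lambda>i. g i \<in> X i) U}" if X: "\<And>i. small (X i)" for X
  proof -
    let ?Y = "insert undefined (\<Union>i\<in>I. X i)"
    let ?C = "{graph_code (vset B) I g | g. g ` I \<subseteq> ?Y}"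
    let ?f = "\<lambda>z. cls (SOME g. graph_code (vset B) I g = z)"
    have "small (?f ` ?C)"
      by (intro small_image small_graph_codes I small_insert small_UN X)
    moreover have "cls g \<in> ?f ` ?C" if g: "eventually (\<lambda>i. g i \<in> X i) U" for g
    proof -
      \<comment> \<open>Off a member of \<open>U\<close> the values of \<open>g\<close> are uncontrolled; changing them there keeps the class.\<close>
      define h where "h i = (if g i \<in> X i then g i else undefined)" for i
      have "cls g = cls h"
        using g by (intro cls_cong) (auto simp: h_def elim: eventually_mono)
      also have "cls h = ?f (graph_code (vset B) I h)"
      proof -
        let ?k = "SOME k. graph_code (vset B) I k = graph_code (vset B) I h"
        have k: "graph_code (vset B) I ?k = graph_code (vset B) I h"
          by (rule someI[of _ h]) simp
        have "eventually (\<lambda>i. h i = ?k i) U"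
          using inI by (rule eventually_mono) (rule graph_code_eqD[OF I k[symmetric]])
        then show ?thesis
          by (rule cls_cong)
      qed
      finally have "cls g = ?f (graph_code (vset B) I h)" .
      moreover have "h ` I \<subseteq> ?Y"
        by (auto simp: h_def)
      ultimately show ?thesis
        by blast
    qed
    ultimately show ?thesis
      by (elim small_subset) blast
  qed
  show thesis
  proof (rule that[of cls])
    show "cls g = cls h \<longleftrightarrow> eventually (\<lambda>i. g i = h i) U" for g h
      using cls_cong[of g h] cls_eqD[of g h] by (rule iffI[rotated])
    show "cls (\<lambda>_. x) = x" if "x \<in> B" for x
      using that by (intro cls_const) (simp add: isc_def)
  qed (rule small_cls)
qed

section \<open>Substructures and isomorphisms\<close>

lemma tuples_mono: "A \<subseteq> B \<Longrightarrow> xs \<in> tuples n A \<Longrightarrow> xs \<in> tuples n B"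
  by (auto simp: tuples_def)

lemma map_tuples: "xs \<in> tuples n A \<Longrightarrow> h ` A \<subseteq> B \<Longrightarrow> map h xs \<in> tuples n B"
  by (auto simp: tuples_def)

lemma tuples_imageE:
  assumes "ys \<in> tuples n (h ` A)"
  obtains xs where "ys = map h xs" "xs \<in> tuples n A"
proof
  have "map (h \<circ> inv_into A h) ys = map id ys"
    using assms by (intro map_cong) (auto simp: tuples_def f_inv_into_f)
  then show "ys = map h (map (inv_into A h) ys)"
    by simp
  show "map (inv_into A h) ys \<in> tuples n A"
    using assms by (intro map_tuples) (auto simp: inv_into_into)
qed

lemma struct_fint_closed:
  "struct_on Sig M \<Longrightarrow> f \<in> fsyms Sig \<Longrightarrow> xs \<in> tuples (farity Sig f) (univ M) \<Longrightarrow>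
    fint M f xs \<in> univ M"
  by (simp add: struct_on_def)

lemma struct_rint_tuples:
  "struct_on Sig M \<Longrightarrow> R \<in> rsyms Sig \<Longrightarrow> xs \<in> rint M R \<Longrightarrow>
    xs \<in> tuples (rarity Sig R) (univ M)"
  by (auto simp: struct_on_def)

text \<open>Because junk values are fixed, a structure is determined by its meaningful part.\<close>

lemma struct_eqI:
  assumes "struct_on Sig A" "struct_on Sig B" "univ A = univ B"
    and "\<And>f xs. f \<in> fsyms Sig \<Longrightarrow> xs \<in> tuples (farity Sig f) (univ A) \<Longrightarrow> fint A f xs = fint B f xs"
    and "\<And>R. R \<in> rsyms Sig \<Longrightarrow> rint A R = rint B R"
  shows "A = (B :: 'v::zfc_universe struct)"
proof -
  have "fint A f xs = fint B f xs" for f xs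
    using assms by (cases "f \<in> fsyms Sig \<and> xs \<in> tuples (farity Sig f) (univ A)")
      (auto simp: struct_on_def)
  moreover have "rint A R = rint B R" for R
    using assms by (cases "R \<in> rsyms Sig") (auto simp: struct_on_def)
  ultimately show ?thesis
    using assms(3) by (intro struct.equality) auto
qed

lemma substruct_subset: "substruct Sig M N \<Longrightarrow> univ M \<subseteq> univ N"
  by (simp add: substruct_def)

lemma substruct_struct_on: "substruct Sig M N \<Longrightarrow> struct_on Sig M \<and> struct_on Sig N"
  by (simp add: substruct_def)

lemma substruct_fint:
  "substruct Sig M N \<Longrightarrow> f \<in> fsyms Sig \<Longrightarrow> xs \<in> tuples (farity Sig f) (univ M) \<Longrightarrow>
    fint M f xs = fint N f xs"
  by (simp add: substruct_def)

lemma substruct_rint: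
  "substruct Sig M N \<Longrightarrow> R \<in> rsyms Sig \<Longrightarrow> xs \<in> tuples (rarity Sig R) (univ M) \<Longrightarrow>
    xs \<in> rint M R \<longleftrightarrow> xs \<in> rint N R"
  by (simp add: substruct_def)

lemma substructI:
  assumes "struct_on Sig M" "struct_on Sig N" "univ M \<subseteq> univ N"
    and "\<And>f xs. f \<in> fsyms Sig \<Longrightarrow> xs \<in> tuples (farity Sig f) (univ M) \<Longrightarrow> fint M f xs = fint N f xs"
    and "\<And>R xs. R \<in> rsyms Sig \<Longrightarrow> xs \<in> tuples (rarity Sig R) (univ M) \<Longrightarrow>
      xs \<in> rint M R \<longleftrightarrow> xs \<in> rint N R"
  shows "substruct Sig M N"
proof -
  have "rint M R = rint N R \<inter> tuples (rarity Sig R) (univ M)" if "R \<in> rsyms Sig" for R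
    using assms(5)[OF that] struct_rint_tuples[OF assms(1) that] by blast
  then show ?thesis
    using assms(1-4) by (simp add: substruct_def)
qed

lemma substruct_of_common:
  assumes "substruct Sig A N" "substruct Sig B N" "univ A \<subseteq> univ B"
  shows "substruct Sig A B"
  using substruct_struct_on[OF assms(1)] substruct_struct_on[OF assms(2)] assms(3)
    substruct_fint[OF assms(1)] substruct_rint[OF assms(1)]
    substruct_fint[OF assms(2) _ tuples_mono[OF assms(3)]]
    substruct_rint[OF assms(2) _ tuples_mono[OF assms(3)]]
  by (intro substructI) simp_all

lemma substruct_unique:
  assumes "substruct Sig A N" "substruct Sig B N" "univ A = univ B"
  shows "A = B"
  using assms by (intro struct_eqI[of Sig]) (auto simp: substruct_def)

definition restr :: "'v::zfc_universe signature \<Rightarrow> 'v struct \<Rightarrow> 'v set \<Rightarrow> 'v struct" where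
  "restr Sig N X =
    \<lparr>univ = X,
     fint = (\<lambda>f xs. if f \<in> fsyms Sig \<and> xs \<in> tuples (farity Sig f) X then fint N f xs else undefined),
     rint = (\<lambda>R. rint N R \<inter> tuples (rarity Sig R) X)\<rparr>"

lemma univ_restr [simp]: "univ (restr Sig N X) = X"
  by (simp add: restr_def)

lemma substruct_restr:
  assumes N: "struct_on Sig N" and X: "X \<subseteq> univ N"
    and closed: "\<And>f xs. f \<in> fsyms Sig \<Longrightarrow> xs \<in> tuples (farity Sig f) X \<Longrightarrow> fint N f xs \<in> X"
  shows "substruct Sig (restr Sig N X) N"
proof -
  have "small X"
    using N X small_subset by (auto simp: struct_on_def)
  then have "struct_on Sig (restr Sig N X)"
    using N closed by (auto simp: struct_on_def restr_def)
  then show ?thesis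
    using N X by (auto simp: substruct_def restr_def)
qed

lemma substruct_eq_restr:
  assumes "substruct Sig A N"
  shows "A = restr Sig N (univ A)"
proof (rule substruct_unique[OF assms])
  have "fint N f xs \<in> univ A" if "f \<in> fsyms Sig" "xs \<in> tuples (farity Sig f) (univ A)" for f xs
    using substruct_fint[OF assms that] substruct_struct_on[OF assms] struct_fint_closed that
    by metis
  then show "substruct Sig (restr Sig N (univ A)) N"
    using assms by (intro substruct_restr) (auto simp: substruct_def)
qed simp

lemma struct_iso_restrict:
  assumes iso: "struct_iso Sig h C C'" and A: "substruct Sig A C" and A': "substruct Sig A' C'"
    and img: "h ` univ A = univ A'"
  shows "struct_iso Sig h A A'"
  unfolding struct_iso_def
proof (intro conjI ballI)
  show "struct_on Sig A" "struct_on Sig A'"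
    using A A' by (simp_all add: substruct_def)
  show "bij_betw h (univ A) (univ A')"
    using iso img substruct_subset[OF A]
    by (auto simp: struct_iso_def bij_betw_def intro: inj_on_subset)
next
  fix f xs assume f: "f \<in> fsyms Sig" and xs: "xs \<in> tuples (farity Sig f) (univ A)"
  have "xs \<in> tuples (farity Sig f) (univ C)" "map h xs \<in> tuples (farity Sig f) (univ A')"
    using tuples_mono[OF substruct_subset[OF A] xs] map_tuples[OF xs, of h "univ A'"] img by auto
  then show "h (fint A f xs) = fint A' f (map h xs)"
    using iso f xs substruct_fint[OF A f] substruct_fint[OF A' f] by (simp add: struct_iso_def)
next
  fix R xs assume R: "R \<in> rsyms Sig" and xs: "xs \<in> tuples (rarity Sig R) (univ A)"
  have "xs \<in> tuples (rarity Sig R) (univ C)" "map h xs \<in> tuples (rarity Sig R) (univ A')"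
    using tuples_mono[OF substruct_subset[OF A] xs] map_tuples[OF xs, of h "univ A'"] img by auto
  then show "xs \<in> rint A R \<longleftrightarrow> map h xs \<in> rint A' R"
    using iso R xs substruct_rint[OF A R] substruct_rint[OF A' R] by (simp add: struct_iso_def)
qed

lemma struct_iso_image:
  assumes iso: "struct_iso Sig h C C'" and A: "substruct Sig A C"
  obtains A' where "struct_iso Sig h A A'" "substruct Sig A' C'" "univ A' = h ` univ A"
proof -
  have hC: "h ` univ C = univ C'" and C': "struct_on Sig C'"
    using iso by (auto simp: struct_iso_def bij_betw_def)
  have "substruct Sig (restr Sig C' (h ` univ A)) C'"
  proof (rule substruct_restr[OF C'])
    show "h ` univ A \<subseteq> univ C'"
      using hC substruct_subset[OF A] by blast
    fix f ys assume f: "f \<in> fsyms Sig" and "ys \<in> tuples (farity Sig f) (h ` univ A)"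
    from tuples_imageE[OF this(2)] obtain xs
      where ys: "ys = map h xs" and xs: "xs \<in> tuples (farity Sig f) (univ A)"
      by blast
    have "fint C' f ys = h (fint C f xs)"
      using iso f tuples_mono[OF substruct_subset[OF A] xs] by (simp add: struct_iso_def ys)
    also have "\<dots> = h (fint A f xs)"
      using substruct_fint[OF A f xs] by simp
    also have "\<dots> \<in> h ` univ A"
      using struct_fint_closed[of Sig A f xs] A f xs by (auto simp: substruct_def)
    finally show "fint C' f ys \<in> h ` univ A" .
  qed
  moreover from this have "struct_iso Sig h A (restr Sig C' (h ` univ A))"
    by (rule struct_iso_restrict[OF iso A]) simp
  ultimately show thesis
    using that by simp
qed

lemma struct_iso_inv:
  assumes iso: "struct_iso Sig h M N"
  shows "struct_iso Sig (inv_into (univ M) h) N M"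
proof -
  let ?k = "inv_into (univ M) h"
  have bij: "bij_betw h (univ M) (univ N)" and M: "struct_on Sig M"
    using iso by (auto simp: struct_iso_def)
  have hk: "map h (map ?k xs) = xs" if "xs \<in> tuples n (univ N)" for n xs
  proof -
    have "map (h \<circ> ?k) xs = map id xs"
      using that bij by (intro map_cong) (auto simp: tuples_def bij_betw_inv_into_right)
    then show ?thesis
      by simp
  qed
  have k: "map ?k xs \<in> tuples n (univ M)" if "xs \<in> tuples n (univ N)" for n xs
    using that bij_betw_inv_into[OF bij] by (intro map_tuples) (auto simp: bij_betw_def)
  show ?thesis
    unfolding struct_iso_def
  proof (intro conjI ballI)
    show "bij_betw ?k (univ N) (univ M)"
      by (rule bij_betw_inv_into[OF bij])
    fix f xs assume f: "f \<in> fsyms Sig" and xs: "xs \<in> tuples (farity Sig f) (univ N)"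
    have "h (fint M f (map ?k xs)) = fint N f xs"
      using iso f k[OF xs] hk[OF xs] by (simp add: struct_iso_def del: map_map)
    then show "?k (fint N f xs) = fint M f (map ?k xs)"
      using bij_betw_inv_into_left[OF bij struct_fint_closed[OF M f k[OF xs]]] by simp
  next
    fix R xs assume "R \<in> rsyms Sig" "xs \<in> tuples (rarity Sig R) (univ N)"
    then show "xs \<in> rint N R \<longleftrightarrow> map ?k xs \<in> rint M R"
      using iso k hk by (simp add: struct_iso_def del: map_map)
  qed (use iso in \<open>auto simp: struct_iso_def\<close>)
qed

text \<open>
  The definite description in \<open>union_struct\<close> is awkward to calculate with. All chains below live
  inside a structure \<open>N\<close> that is given in advance, where the values can be read off.
\<close>

lemma union_struct_eq_restr:
  assumes sub: "\<And>i. i \<in> I \<Longrightarrow> substruct Sig (Ms i) N"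
    and dir: "\<And>F. finite F \<Longrightarrow> F \<subseteq> (\<Union>i\<in>I. univ (Ms i)) \<Longrightarrow> \<exists>i\<in>I. F \<subseteq> univ (Ms i)"
    and N: "struct_on Sig N"
  shows "union_struct Sig I Ms = restr Sig N (\<Union>i\<in>I. univ (Ms i))"
proof -
  let ?X = "\<Union>i\<in>I. univ (Ms i)"
  have dir': "\<exists>i\<in>I. xs \<in> tuples n (univ (Ms i))" if "xs \<in> tuples n ?X" for n xs
    using dir[of "set xs"] that by (auto simp: tuples_def)
  have "(THE y. \<exists>i\<in>I. set xs \<subseteq> univ (Ms i) \<and> y = fint (Ms i) f xs) = fint N f xs"
    if "f \<in> fsyms Sig" "xs \<in> tuples (farity Sig f) ?X" for f xs
  proof (rule the_equality)
    show "\<exists>i\<in>I. set xs \<subseteq> univ (Ms i) \<and> fint N f xs = fint (Ms i) f xs"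
      using dir'[OF that(2)] substruct_fint[OF sub that(1)] by (fastforce simp: tuples_def)
    show "y = fint N f xs" if "\<exists>i\<in>I. set xs \<subseteq> univ (Ms i) \<and> y = fint (Ms i) f xs" for y
      using that \<open>xs \<in> tuples (farity Sig f) ?X\<close> substruct_fint[OF sub \<open>f \<in> fsyms Sig\<close>]
      by (auto simp: tuples_def)
  qed
  then have fint: "(if f \<in> fsyms Sig \<and> xs \<in> tuples (farity Sig f) ?X
      then THE y. \<exists>i\<in>I. set xs \<subseteq> univ (Ms i) \<and> y = fint (Ms i) f xs else undefined)
      = (if f \<in> fsyms Sig \<and> xs \<in> tuples (farity Sig f) ?X then fint N f xs else undefined)" for f xs
    by simp
  have rint: "(\<Union>i\<in>I. rint (Ms i) R) = rint N R \<inter> tuples (rarity Sig R) ?X" for R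
  proof (cases "R \<in> rsyms Sig")
    case True
    show ?thesis
    proof (intro set_eqI iffI)
      fix xs assume "xs \<in> (\<Union>i\<in>I. rint (Ms i) R)"
      then obtain i where i: "i \<in> I" "xs \<in> rint (Ms i) R"
        by blast
      then have "xs \<in> rint N R \<inter> tuples (rarity Sig R) (univ (Ms i))"
        using sub[OF i(1)] True by (simp add: substruct_def)
      then show "xs \<in> rint N R \<inter> tuples (rarity Sig R) ?X"
        using i(1) by (auto simp: tuples_def)
    next
      fix xs assume xs: "xs \<in> rint N R \<inter> tuples (rarity Sig R) ?X"
      then obtain i where i: "i \<in> I" "xs \<in> tuples (rarity Sig R) (univ (Ms i))"
        using dir' by blast
      then show "xs \<in> (\<Union>i\<in>I. rint (Ms i) R)"
        using xs substruct_rint[OF sub[OF i(1)] True i(2)] by blast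
    qed
  next
    case False
    then have "rint N R = {}" and "i \<in> I \<Longrightarrow> rint (Ms i) R = {}" for i
      using N sub[of i] by (auto simp: substruct_def struct_on_def)
    then show ?thesis
      by simp
  qed
  show ?thesis
    unfolding union_struct_def restr_def by (simp only: fint rint)
qed

section \<open>Abstract elementary classes are closed under directed unions\<close>

locale aec =
  fixes Sig :: "'v::zfc_universe signature" and K :: "'v struct set" and le :: "'v struct rel"
  assumes AEC: "AEC Sig K le"
begin

lemmas AEC_unfolded = AEC[unfolded AEC_def]

lemma K_struct: "M \<in> K \<Longrightarrow> struct_on Sig M"
  using AEC_basics(2)[OF AEC] by blast

lemma le_substruct: "(M, N) \<in> le \<Longrightarrow> substruct Sig M N"
  using AEC_basics(3)[OF AEC] by blast

lemma le_subset: "(M, N) \<in> le \<Longrightarrow> univ M \<subseteq> univ N"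
  by (rule substruct_subset[OF le_substruct])

lemma le_K: "(M, N) \<in> le \<Longrightarrow> M \<in> K" "(M, N) \<in> le \<Longrightarrow> N \<in> K"
  using AEC_basics(1)[OF AEC] by (auto simp: partial_order_on_def preorder_on_def)

lemma le_refl: "M \<in> K \<Longrightarrow> (M, M) \<in> le"
  using AEC_basics(1)[OF AEC] by (simp add: partial_order_on_def preorder_on_def refl_on_def)

lemma le_trans: "(M, N) \<in> le \<Longrightarrow> (N, L) \<in> le \<Longrightarrow> (M, L) \<in> le"
  using AEC_basics(1)[OF AEC] by (auto simp: partial_order_on_def preorder_on_def dest: transD)

lemma iso_le:
  "(M, N) \<in> le \<Longrightarrow> struct_iso Sig h N N' \<Longrightarrow> struct_iso Sig h M M' \<Longrightarrow> (M', N') \<in> le"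
  using AEC_unfolded[THEN conjunct2, THEN conjunct2, THEN conjunct2, THEN conjunct2, THEN conjunct2,
      THEN conjunct1] by blast

lemma coherence: "(M0, M2) \<in> le \<Longrightarrow> (M1, M2) \<in> le \<Longrightarrow> univ M0 \<subseteq> univ M1 \<Longrightarrow> (M0, M1) \<in> le"
  using AEC_unfolded[THEN conjunct2, THEN conjunct2, THEN conjunct2, THEN conjunct2, THEN conjunct2,
      THEN conjunct2, THEN conjunct1] substruct_of_common[OF le_substruct le_substruct] by blast

lemma chain_union:
  assumes "limit_order r" "\<forall>i j. (i, j) \<in> r \<longrightarrow> (Ms i, Ms j) \<in> le"
  shows "union_struct Sig (Field r) Ms \<in> K"
    and "i \<in> Field r \<Longrightarrow> (Ms i, union_struct Sig (Field r) Ms) \<in> le"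
    and "(\<And>i. i \<in> Field r \<Longrightarrow> (Ms i, N) \<in> le) \<Longrightarrow> (union_struct Sig (Field r) Ms, N) \<in> le"
proof -
  note * = AEC_unfolded[THEN conjunct2, THEN conjunct2, THEN conjunct2, THEN conjunct2,
      THEN conjunct2, THEN conjunct2, THEN conjunct2, THEN conjunct1, THEN spec, THEN spec, THEN mp,
      OF assms(1), THEN mp, OF assms(2)]
  show "union_struct Sig (Field r) Ms \<in> K"
    by (rule *[THEN conjunct1])
  show "i \<in> Field r \<Longrightarrow> (Ms i, union_struct Sig (Field r) Ms) \<in> le"
    by (rule *[THEN conjunct2, THEN conjunct1, THEN bspec])
  assume "\<And>i. i \<in> Field r \<Longrightarrow> (Ms i, N) \<in> le"
  then have "\<forall>i\<in>Field r. (Ms i, N) \<in> le"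
    by blast
  then show "(union_struct Sig (Field r) Ms, N) \<in> le"
    by (rule *[THEN conjunct2, THEN conjunct2, THEN spec, THEN mp])
qed

lemma LS_bound_LS: "LS_bound Sig K le (LS Sig K le)"
proof -
  obtain \<theta> where "LS_bound Sig K le \<theta>"
    using AEC_unfolded by (elim conjE exE) (rule that)
  then have "{\<theta>. LS_bound Sig K le \<theta>} \<noteq> {}"
    by blast
  moreover have "\<forall>\<theta>\<in>{\<theta>. LS_bound Sig K le \<theta>}. Card_order \<theta>"
    by (simp add: LS_bound_def cardinal_def)
  ultimately have "\<exists>\<theta>\<in>{\<theta>. LS_bound Sig K le \<theta>}. \<forall>\<theta>'\<in>{\<theta>. LS_bound Sig K le \<theta>}. \<theta> \<le>o \<theta>'"
    by (rule exists_minim_Card_order)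
  then have "\<exists>\<theta>. LS_bound Sig K le \<theta> \<and> (\<forall>\<theta>'. LS_bound Sig K le \<theta>' \<longrightarrow> \<theta> \<le>o \<theta>')"
    by simp
  then show ?thesis
    unfolding LS_def by (rule someI2_ex) simp
qed

lemma LS_cardinal: "cardinal (LS Sig K le)"
  and LS_infinite: "infinite (Field (LS Sig K le))"
  and LS_signature: "|fsyms Sig <+> rsyms Sig| \<le>o LS Sig K le"
  using LS_bound_LS by (simp_all add: LS_bound_def)

lemma LS_down:
  assumes "M \<in> K" "A \<subseteq> univ M" "|A| \<le>o r" "LS Sig K le \<le>o r" "Card_order r"
  obtains N where "(N, M) \<in> le" "A \<subseteq> univ N" "|univ N| \<le>o r"
proof -
  obtain N where N: "(N, M) \<in> le" "A \<subseteq> univ N" "|univ N| \<le>o |A| +c LS Sig K le"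
    using LS_bound_LS assms(1,2) unfolding LS_bound_def by blast
  have "Cinfinite (LS Sig K le)"
    using LS_infinite LS_cardinal by (simp add: cinfinite_def cardinal_def)
  then have "Cinfinite r"
    using cinfinite_mono[OF assms(4)] assms(5) by blast
  then have "|A| +c LS Sig K le \<le>o r"
    using assms LS_cardinal by (intro csum_cinfinite_bound) (auto simp: cardinal_def card_of_Card_order)
  then show thesis
    using that N ordLeq_transitive by blast
qed

end

lemma finite_subset_underS:
  assumes r: "Card_order r" and inf: "infinite (Field r)" and "finite a" "a \<subseteq> Field r"
  shows "\<exists>i\<in>Field r. a \<subseteq> underS r i"
  using assms(3,4)
proof (induction a)
  case empty
  then show ?case
    using inf by (auto simp: ex_in_conv)
next
  case (insert x a)
  have lin: "Linear_order r" and tr: "trans r" and as: "antisym r" and tot: "Total r"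
    using r by (auto simp: card_order_on_def well_order_on_def linear_order_on_def
        partial_order_on_def preorder_on_def)
  have rf: "Refl r"
    using lin by (auto simp: linear_order_on_def partial_order_on_def preorder_on_def)
  obtain i where i: "i \<in> Field r" "a \<subseteq> underS r i"
    using insert by auto
  obtain m where m: "m \<in> Field r" "(x, m) \<in> r" "(i, m) \<in> r"
    using tot rf i(1) insert.prems unfolding total_on_def refl_on_def by (metis insert_subset)
  obtain j where j: "j \<in> Field r" "m \<noteq> j" "(m, j) \<in> r"
    using infinite_Card_order_limit[OF r inf m(1)] by blast
  have below: "y \<in> underS r j" if "(y, m) \<in> r" for y
    using that j tr as unfolding underS_def by (auto dest: transD antisymD)
  have "y \<in> underS r j" if "y \<in> insert x a" for y
    using that i(2) m tr by (intro below) (auto simp: underS_def dest: transD)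
  then show ?case
    using j(1) by blast
qed

context aec
begin

text \<open>
  The axioms only speak of well-ordered chains. For a system of structures indexed by the finite
  subsets of \<open>D\<close>, one can restrict the system to any subset \<open>X\<close> of \<open>D\<close> and argue by
  induction on the cardinality of \<open>X\<close>: an infinite \<open>X\<close> is the union of a well-ordered chain of
  subsets of smaller cardinality, and every finite subset of \<open>X\<close> is captured along the chain.
  The smoothness clause of the induction hypothesis makes the unions along this chain increasing.
\<close>

lemma finite_subset_system_union:
  fixes D :: "'v set"
  assumes N: "struct_on Sig N" and D: "small D"
    and sub: "\<And>a. finite a \<Longrightarrow> a \<subseteq> D \<Longrightarrow> substruct Sig (M a) N"
    and mono: "\<And>a b. finite b \<Longrightarrow> b \<subseteq> D \<Longrightarrow> a \<subseteq> b \<Longrightarrow> (M a, M b) \<in> le"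
    and "X \<subseteq> D"
  shows "restr Sig N (\<Union>a\<in>{a. finite a \<and> a \<subseteq> X}. univ (M a)) \<in> K \<and>
    (\<forall>a. finite a \<longrightarrow> a \<subseteq> X \<longrightarrow>
      (M a, restr Sig N (\<Union>a\<in>{a. finite a \<and> a \<subseteq> X}. univ (M a))) \<in> le) \<and>
    (\<forall>L. (\<forall>a. finite a \<longrightarrow> a \<subseteq> X \<longrightarrow> (M a, L) \<in> le) \<longrightarrow>
      (restr Sig N (\<Union>a\<in>{a. finite a \<and> a \<subseteq> X}. univ (M a)), L) \<in> le)"
proof -
  define W where "W X = (\<Union>a\<in>{a. finite a \<and> a \<subseteq> X}. univ (M a))" for X
  let ?P = "\<lambda>X. restr Sig N (W X) \<in> K \<and>
    (\<forall>a. finite a \<longrightarrow> a \<subseteq> X \<longrightarrow> (M a, restr Sig N (W X)) \<in> le) \<and>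
    (\<forall>L. (\<forall>a. finite a \<longrightarrow> a \<subseteq> X \<longrightarrow> (M a, L) \<in> le) \<longrightarrow> (restr Sig N (W X), L) \<in> le)"
  have inW: "univ (M a) \<subseteq> W X" if "finite a" "a \<subseteq> X" for a X
    using that by (auto simp: W_def)
  have finW: "\<exists>a. finite a \<and> a \<subseteq> X \<and> F \<subseteq> univ (M a)" if "finite F" "F \<subseteq> W X" "X \<subseteq> D" for F X
    using that(1,2)
  proof (induction F)
    case empty
    then show ?case
      by (intro exI[of _ "{}"]) simp
  next
    case (insert x F)
    then obtain a b where ab: "finite a" "a \<subseteq> X" "F \<subseteq> univ (M a)" "finite b" "b \<subseteq> X" "x \<in> univ (M b)"
      by (auto simp: W_def)
    then have "(M a, M (a \<union> b)) \<in> le" "(M b, M (a \<union> b)) \<in> le"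
      using \<open>X \<subseteq> D\<close> by (auto intro!: mono)
    then have "insert x F \<subseteq> univ (M (a \<union> b))"
      using ab le_subset by blast
    then show ?case
      using ab by (intro exI[of _ "a \<union> b"]) simp
  qed
  have subW: "substruct Sig (restr Sig N (W X)) N" if XD: "X \<subseteq> D" for X
  proof (rule substruct_restr[OF N])
    show "W X \<subseteq> univ N"
      unfolding W_def using that by (intro UN_least substruct_subset[OF sub]) auto
    fix f xs assume f: "f \<in> fsyms Sig" and xs: "xs \<in> tuples (farity Sig f) (W X)"
    then obtain a where a: "finite a" "a \<subseteq> X" "set xs \<subseteq> univ (M a)"
      using finW[OF _ _ XD, of "set xs"] by (auto simp: tuples_def)
    then have s: "substruct Sig (M a) N" and xs: "xs \<in> tuples (farity Sig f) (univ (M a))"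
      using sub that xs by (auto simp: tuples_def)
    then have "fint N f xs \<in> univ (M a)"
      using struct_fint_closed[OF _ f xs] substruct_fint[OF s f xs] by (simp add: substruct_def)
    then show "fint N f xs \<in> W X"
      using inW[OF a(1,2)] by blast
  qed
  have "X \<subseteq> D \<longrightarrow> ?P X" for X
  proof (induction X rule: wf_induct_rule[OF wf_inv_image[OF wf_ordLess, of card_of]])
    case (1 X)
    show ?case
    proof (cases "finite X")
      case True
      show ?thesis
      proof
        assume "X \<subseteq> D"
        have "univ (M a) \<subseteq> univ (M X)" if "a \<subseteq> X" for a
          using mono[OF True \<open>X \<subseteq> D\<close> that] by (rule le_subset)
        then have "W X = univ (M X)"
          using True by (auto simp: W_def)
        then have "restr Sig N (W X) = M X"
          using substruct_eq_restr[OF sub[OF True \<open>X \<subseteq> D\<close>]] by simp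
        then show "?P X"
          using mono[OF True \<open>X \<subseteq> D\<close>] le_K True by auto
      qed
    next
      case False
      show ?thesis
      proof
        assume "X \<subseteq> D"
        let ?r = "|X|"
        have r: "Card_order ?r"
          by (rule card_of_Card_order)
        have FX: "Field ?r = X"
          by (rule Field_card_of)
        let ?V = "underS ?r"
        let ?Ms = "\<lambda>i. restr Sig N (W (?V i))"
        have VX: "?V i \<subseteq> X" for i
          using FX by (auto simp: underS_def Field_def)
        have IH: "?P (?V i)" if "i \<in> X" for i
        proof -
          have "|?V i| <o |X|"
            using card_of_underS[OF r] that FX by simp
          then show ?thesis
            using 1[of "?V i"] VX[of i] \<open>X \<subseteq> D\<close> by (auto simp: in_inv_image)
        qed
        have lim: "limit_order ?r"
          unfolding limit_order_def
        proof (intro conjI ballI)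
          show "Well_order ?r"
            using r by (simp add: card_order_on_def)
          show "small (Field ?r)" "Field ?r \<noteq> {}"
            using small_subset[OF D \<open>X \<subseteq> D\<close>] False FX by auto
          fix i assume "i \<in> Field ?r"
          then show "\<exists>j. j \<noteq> i \<and> (i, j) \<in> ?r"
            using infinite_Card_order_limit[OF r, of i] False FX by auto
        qed
        have Ms_mono: "(?Ms i, ?Ms j) \<in> le" if "(i, j) \<in> ?r" for i j
        proof -
          have ij: "i \<in> X" "j \<in> X"
            using that FX by (auto simp: Field_def)
          have "?V i \<subseteq> ?V j"
            using r that by (intro underS_incr) (auto simp: card_order_on_def well_order_on_def
                linear_order_on_def partial_order_on_def preorder_on_def)
          then have "(M a, ?Ms j) \<in> le" if "finite a" "a \<subseteq> ?V i" for a
            using IH[OF ij(2)] that by blast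
          then show ?thesis
            using IH[OF ij(1)] by blast
        qed
        have capture: "\<exists>i\<in>X. a \<subseteq> ?V i" if "finite a" "a \<subseteq> X" for a
          using finite_subset_underS[OF r, of a] that False FX by simp
        have WX: "(\<Union>i\<in>X. W (?V i)) = W X"
        proof
          show "(\<Union>i\<in>X. W (?V i)) \<subseteq> W X"
            using VX unfolding W_def by fast
          show "W X \<subseteq> (\<Union>i\<in>X. W (?V i))"
            using capture unfolding W_def by fast
        qed
        have "union_struct Sig X ?Ms = restr Sig N (\<Union>i\<in>X. univ (?Ms i))"
        proof (rule union_struct_eq_restr[OF _ _ N])
          show "substruct Sig (?Ms i) N" if "i \<in> X" for i
            using VX \<open>X \<subseteq> D\<close> by (intro subW) blast
          fix F assume "finite F" "F \<subseteq> (\<Union>i\<in>X. univ (?Ms i))"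
          then have "F \<subseteq> W X"
            using WX by simp
          from finW[OF \<open>finite F\<close> this \<open>X \<subseteq> D\<close>] obtain a where
            a: "finite a" "a \<subseteq> X" "F \<subseteq> univ (M a)"
            by blast
          then obtain i where "i \<in> X" "a \<subseteq> ?V i"
            using capture by blast
          then have "F \<subseteq> W (?V i)"
            using a inW[of a "?V i"] by blast
          then show "\<exists>i\<in>X. F \<subseteq> univ (?Ms i)"
            using \<open>i \<in> X\<close> by auto
        qed
        then have U: "union_struct Sig X ?Ms = restr Sig N (W X)"
          using WX by simp
        have "\<forall>i j. (i, j) \<in> ?r \<longrightarrow> (?Ms i, ?Ms j) \<in> le"
          using Ms_mono by blast
        note chain = chain_union[OF lim this, unfolded FX U]
        show "?P X"
        proof (intro conjI allI impI)
          show "restr Sig N (W X) \<in> K"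
            by (rule chain(1))
        next
          fix a assume a: "finite a" "a \<subseteq> X"
          then obtain i where i: "i \<in> X" "a \<subseteq> ?V i"
            using capture by blast
          then have "(M a, ?Ms i) \<in> le"
            using IH[OF i(1)] a(1) by simp
          then show "(M a, restr Sig N (W X)) \<in> le"
            using chain(2)[OF i(1)] by (rule le_trans)
        next
          fix L assume L: "\<forall>a. finite a \<longrightarrow> a \<subseteq> X \<longrightarrow> (M a, L) \<in> le"
          show "(restr Sig N (W X), L) \<in> le"
          proof (rule chain(3))
            fix i assume "i \<in> X"
            have "(M a, L) \<in> le" if "finite a" "a \<subseteq> ?V i" for a
              using L that VX[of i] by blast
            then show "(?Ms i, L) \<in> le"
              using IH[OF \<open>i \<in> X\<close>] by blast
          qed
        qed
      qed
    qed
  qed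
  then show ?thesis
    using \<open>X \<subseteq> D\<close> unfolding W_def by simp
qed

text \<open>
  A directed family is turned into a system indexed by finite sets of elements of its union, by
  choosing upper bounds along the well-founded inclusion of finite sets. The system can be made to
  lie above any prescribed member \<open>A\<close> of the family, which is how \<open>A\<close> is seen to be strong in
  the union although it need not occur in the system.
\<close>

lemma directed_union:
  assumes N: "struct_on Sig N" and ne: "D \<noteq> {}"
    and sub: "\<forall>A\<in>D. A \<in> K \<and> substruct Sig A N"
    and dir: "\<forall>A\<in>D. \<forall>B\<in>D. \<exists>C\<in>D. (A, C) \<in> le \<and> (B, C) \<in> le"
    and cover: "univ N \<subseteq> (\<Union>A\<in>D. univ A)"
  shows "N \<in> K" and "A \<in> D \<Longrightarrow> (A, N) \<in> le"
    and "(\<And>A. A \<in> D \<Longrightarrow> (A, L) \<in> le) \<Longrightarrow> (N, L) \<in> le"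
proof -
  have bound: "\<exists>C\<in>D. \<forall>A\<in>E. (A, C) \<in> le" if "finite E" "E \<subseteq> D" for E
    using that
  proof (induction E)
    case empty
    then show ?case
      using ne by blast
  next
    case (insert A E)
    then obtain B where B: "B \<in> D" "\<forall>A\<in>E. (A, B) \<in> le"
      by auto
    then obtain C where "C \<in> D" "(A, C) \<in> le" "(B, C) \<in> le"
      using dir insert.prems by blast
    then show ?case
      using B le_trans by blast
  qed
  have main: "N \<in> K \<and> (A, N) \<in> le \<and> (\<forall>L. (\<forall>A\<in>D. (A, L) \<in> le) \<longrightarrow> (N, L) \<in> le)"
    if A: "A \<in> D" for A
  proof -
    let ?Q = "\<lambda>f a r. finite a \<and> a \<subseteq> univ N \<longrightarrow>
      r \<in> D \<and> a \<subseteq> univ r \<and> (A, r) \<in> le \<and> (\<forall>b. b \<subset> a \<longrightarrow> (f b, r) \<in> le)"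
    have "\<exists>f. \<forall>a. ?Q f a (f a)"
    proof (rule dependent_wf_choice[OF wf_finite_psubset])
      fix f g :: "'v set \<Rightarrow> 'v struct" and a r
      assume "\<And>z. (z, a) \<in> finite_psubset \<Longrightarrow> f z = g z"
      then have "finite a \<Longrightarrow> b \<subset> a \<Longrightarrow> f b = g b" for b
        by (simp add: finite_psubset_def)
      then show "?Q f a r = ?Q g a r"
        by auto
    next
      fix a and f :: "'v set \<Rightarrow> 'v struct"
      assume IH: "\<And>b. (b, a) \<in> finite_psubset \<Longrightarrow> ?Q f b (f b)"
      show "\<exists>r. ?Q f a r"
      proof (cases "finite a \<and> a \<subseteq> univ N")
        case True
        have "\<forall>x\<in>a. \<exists>B\<in>D. x \<in> univ B"
          using True cover by auto
        then obtain c where c: "\<And>x. x \<in> a \<Longrightarrow> c x \<in> D \<and> x \<in> univ (c x)"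
          by metis
        let ?E = "insert A (c ` a \<union> f ` {b. b \<subset> a})"
        have fD: "f b \<in> D" if "b \<subset> a" for b
          using IH[of b] that True finite_subset[of b a] by (auto simp: finite_psubset_def)
        have "finite {b. b \<subset> a}"
          using True by (auto intro: finite_subset[of _ "Pow a"])
        then have "finite ?E"
          using True by simp
        moreover have "?E \<subseteq> D"
          using A c fD by auto
        ultimately obtain C where C: "C \<in> D" "\<forall>B\<in>?E. (B, C) \<in> le"
          using bound by meson
        have "x \<in> univ C" if "x \<in> a" for x
          using le_subset[of "c x" C] C(2) c[OF that] that by auto
        then show ?thesis
          using C by (intro exI[of _ C]) auto
      qed auto
    qed
    then obtain M where M: "\<And>a. ?Q M a (M a)"
      by blast
    have subM: "substruct Sig (M a) N" if "finite a" "a \<subseteq> univ N" for a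
      using M[of a] sub that by blast
    have monoM: "(M a, M b) \<in> le" if "finite b" "b \<subseteq> univ N" "a \<subseteq> b" for a b
      using M[of b] sub that le_refl by (cases "a = b") auto
    have "univ N = (\<Union>a\<in>{a. finite a \<and> a \<subseteq> univ N}. univ (M a))"
    proof
      have "x \<in> univ (M {x})" if "x \<in> univ N" for x
        using M[of "{x}"] that by simp
      then show "univ N \<subseteq> (\<Union>a\<in>{a. finite a \<and> a \<subseteq> univ N}. univ (M a))"
        by (intro subsetI UN_I[where a = "{_}"]) auto
      show "(\<Union>a\<in>{a. finite a \<and> a \<subseteq> univ N}. univ (M a)) \<subseteq> univ N"
        using subM substruct_subset by blast
    qed
    moreover have "substruct Sig N N"
      using N by (intro substructI) auto
    ultimately have NR: "restr Sig N (\<Union>a\<in>{a. finite a \<and> a \<subseteq> univ N}. univ (M a)) = N"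
      using substruct_eq_restr by metis
    have sm: "small (univ N)"
      using N by (simp add: struct_on_def)
    note sys = finite_subset_system_union[where M = M, OF N sm subM monoM order_refl, unfolded NR]
    have "(A, M {}) \<in> le"
      using M[of "{}"] by simp
    moreover have "(M {}, N) \<in> le"
      using sys by simp
    ultimately have "(A, N) \<in> le"
      by (rule le_trans)
    moreover have "(N, L) \<in> le" if "\<forall>A\<in>D. (A, L) \<in> le" for L
      using sys M that by simp
    ultimately show ?thesis
      using sys by blast
  qed
  show "N \<in> K"
    using main ne by blast
  show "(A, N) \<in> le" if "A \<in> D"
    using main that by blast
  show "(N, L) \<in> le" if "\<And>A. A \<in> D \<Longrightarrow> (A, L) \<in> le"
    using main ne that by blast
qed

end

section \<open>Ultraproducts of structures\<close>

text \<open>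
  The locale abstracts from the coding of classes of functions. The factors are indexed by the whole
  universe, but only the indices in a member of the filter matter; hypotheses on the factors
  are therefore always required to hold eventually.
\<close>

locale ultraproduct =
  fixes U :: "'v::zfc_universe filter" and cls :: "('v \<Rightarrow> 'v) \<Rightarrow> 'v"
  assumes cls_eq_iff: "cls g = cls h \<longleftrightarrow> eventually (\<lambda>i. g i = h i) U"
    and small_classes: "(\<And>i. small (X i)) \<Longrightarrow> small {cls g | g. eventually (\<lambda>i. g i \<in> X i) U}"
    and ultra: "ultrafilter U"
begin

definition rep :: "'v \<Rightarrow> 'v \<Rightarrow> 'v" where
  "rep x = (SOME g. cls g = x)"

definition coords :: "'v list \<Rightarrow> 'v \<Rightarrow> 'v list" where
  "coords xs i = map (\<lambda>x. rep x i) xs"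

definition classes :: "('v \<Rightarrow> 'v set) \<Rightarrow> 'v set" where
  "classes X = {cls g | g. eventually (\<lambda>i. g i \<in> X i) U}"

definition ult :: "'v signature \<Rightarrow> ('v \<Rightarrow> 'v struct) \<Rightarrow> 'v struct" where
  "ult Sig N =
    \<lparr>univ = classes (\<lambda>i. univ (N i)),
     fint = (\<lambda>f xs. if f \<in> fsyms Sig \<and> xs \<in> tuples (farity Sig f) (classes (\<lambda>i. univ (N i)))
               then cls (\<lambda>i. fint (N i) f (coords xs i)) else undefined),
     rint = (\<lambda>R. if R \<in> rsyms Sig
               then {xs \<in> tuples (rarity Sig R) (classes (\<lambda>i. univ (N i))).
                 eventually (\<lambda>i. coords xs i \<in> rint (N i) R) U} else {})\<rparr>"

definition ult_map :: "('v \<Rightarrow> 'v \<Rightarrow> 'v) \<Rightarrow> 'v \<Rightarrow> 'v" where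
  "ult_map h x = cls (\<lambda>i. h i (rep x i))"

lemma cls_rep_cls [simp]: "cls (rep (cls g)) = cls g"
  unfolding rep_def by (rule someI[of "\<lambda>h. cls h = cls g" g]) (rule refl)

lemma ev_rep_cls: "eventually (\<lambda>i. rep (cls g) i = g i) U"
  using cls_rep_cls[of g] by (simp only: cls_eq_iff)

lemma classesE:
  assumes "x \<in> classes X"
  obtains g where "x = cls g" "eventually (\<lambda>i. g i \<in> X i) U"
  using assms by (auto simp: classes_def)

lemma cls_in_classes: "cls g \<in> classes X \<longleftrightarrow> eventually (\<lambda>i. g i \<in> X i) U"
proof
  assume "cls g \<in> classes X"
  then obtain h where "cls g = cls h" "eventually (\<lambda>i. h i \<in> X i) U"
    by (rule classesE)
  then show "eventually (\<lambda>i. g i \<in> X i) U"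
    unfolding cls_eq_iff by eventually_elim simp
qed (auto simp: classes_def)

lemma ev_rep_in: "x \<in> classes X \<Longrightarrow> eventually (\<lambda>i. rep x i \<in> X i) U"
proof (erule classesE)
  fix g assume x: "x = cls g" and g: "eventually (\<lambda>i. g i \<in> X i) U"
  show "eventually (\<lambda>i. rep x i \<in> X i) U"
    using g ev_rep_cls[of g] unfolding x by eventually_elim simp
qed

lemma ev_map_eq:
  assumes "\<And>x. x \<in> set xs \<Longrightarrow> eventually (\<lambda>i. p x i = q x i) U"
  shows "eventually (\<lambda>i. map (\<lambda>x. p x i) xs = map (\<lambda>x. q x i) xs) U"
proof -
  have "eventually (\<lambda>i. \<forall>x\<in>set xs. p x i = q x i) U"
    using assms by (intro eventually_ball_finite) auto
  then show ?thesis
    by (rule eventually_mono) simp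
qed

lemma ev_coords_map: "eventually (\<lambda>i. coords (map (\<lambda>x. cls (p x)) xs) i = map (\<lambda>x. p x i) xs) U"
proof -
  have "eventually (\<lambda>i. map (\<lambda>x. rep (cls (p x)) i) xs = map (\<lambda>x. p x i) xs) U"
    by (rule ev_map_eq) (rule ev_rep_cls)
  then show ?thesis
    by (simp add: coords_def comp_def del: map_eq_conv)
qed

lemma ev_coords_tuples:
  assumes "xs \<in> tuples n (classes X)"
  shows "eventually (\<lambda>i. coords xs i \<in> tuples n (X i)) U"
proof -
  have "eventually (\<lambda>i. \<forall>x\<in>set xs. rep x i \<in> X i) U"
    using assms by (intro eventually_ball_finite) (auto simp: tuples_def ev_rep_in)
  then show ?thesis
    using assms by (auto simp: tuples_def coords_def elim: eventually_mono)
qed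

lemma univ_ult [simp]: "univ (ult Sig N) = classes (\<lambda>i. univ (N i))"
  by (simp add: ult_def)

lemma fint_ult:
  "f \<in> fsyms Sig \<Longrightarrow> xs \<in> tuples (farity Sig f) (univ (ult Sig N)) \<Longrightarrow>
    fint (ult Sig N) f xs = cls (\<lambda>i. fint (N i) f (coords xs i))"
  by (simp add: ult_def)

lemma rint_ult:
  "R \<in> rsyms Sig \<Longrightarrow> xs \<in> tuples (rarity Sig R) (univ (ult Sig N)) \<Longrightarrow>
    xs \<in> rint (ult Sig N) R \<longleftrightarrow> eventually (\<lambda>i. coords xs i \<in> rint (N i) R) U"
  by (simp add: ult_def)

lemma struct_on_ult:
  assumes N: "eventually (\<lambda>i. struct_on Sig (N i)) U"
  shows "struct_on Sig (ult Sig N)"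
  unfolding struct_on_def
proof (intro conjI ballI allI impI)
  let ?X = "\<lambda>i. if small (univ (N i)) then univ (N i) else {}"
  have "small (classes ?X)"
    unfolding classes_def by (intro small_classes) simp
  moreover have "classes ?X = classes (\<lambda>i. univ (N i))"
  proof -
    have "eventually (\<lambda>i. g i \<in> ?X i) U \<longleftrightarrow> eventually (\<lambda>i. g i \<in> univ (N i)) U" for g
      using N by (intro eventually_subst) (auto simp: struct_on_def elim: eventually_mono)
    then show ?thesis
      by (simp add: classes_def)
  qed
  ultimately show "small (univ (ult Sig N))"
    by simp
next
  fix f xs assume f: "f \<in> fsyms Sig" and xs: "xs \<in> tuples (farity Sig f) (univ (ult Sig N))"
  have "eventually (\<lambda>i. coords xs i \<in> tuples (farity Sig f) (univ (N i))) U"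
    using xs by (intro ev_coords_tuples) simp
  then have "eventually (\<lambda>i. fint (N i) f (coords xs i) \<in> univ (N i)) U"
    using N by eventually_elim (rule struct_fint_closed[OF _ f])
  then show "fint (ult Sig N) f xs \<in> univ (ult Sig N)"
    using f xs by (simp add: fint_ult cls_in_classes del: univ_ult) (simp add: cls_in_classes)
qed (auto simp: ult_def)

lemma ult_map_cls: "ult_map h (cls g) = cls (\<lambda>i. h i (g i))"
  unfolding ult_map_def cls_eq_iff using ev_rep_cls[of g] by (rule eventually_mono) simp

lemma struct_iso_ult:
  assumes iso: "eventually (\<lambda>i. struct_iso Sig (h i) (M i) (N i)) U"
  shows "struct_iso Sig (ult_map h) (ult Sig M) (ult Sig N)"
proof -
  have bij: "eventually (\<lambda>i. bij_betw (h i) (univ (M i)) (univ (N i))) U"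
    and M: "eventually (\<lambda>i. struct_on Sig (M i)) U" and N: "eventually (\<lambda>i. struct_on Sig (N i)) U"
    using iso by (auto simp: struct_iso_def elim: eventually_mono)
  have coords: "eventually (\<lambda>i. coords (map (ult_map h) xs) i = map (h i) (coords xs i)) U" for xs
    using ev_coords_map[of "\<lambda>x i. h i (rep x i)" xs]
    by (simp add: ult_map_def[abs_def] coords_def comp_def)
  have bij_ult: "bij_betw (ult_map h) (univ (ult Sig M)) (univ (ult Sig N))"
    unfolding univ_ult
  proof (rule bij_betw_imageI)
    show "inj_on (ult_map h) (classes (\<lambda>i. univ (M i)))"
    proof (rule inj_onI, elim classesE)
      fix x y g k
      assume eq: "ult_map h x = ult_map h y" and x: "x = cls g" and y: "y = cls k"
        and g: "eventually (\<lambda>i. g i \<in> univ (M i)) U" and k: "eventually (\<lambda>i. k i \<in> univ (M i)) U"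
      have "eventually (\<lambda>i. h i (g i) = h i (k i)) U"
        using eq unfolding x y ult_map_cls cls_eq_iff .
      then have "eventually (\<lambda>i. g i = k i) U"
        using bij g k by eventually_elim (auto simp: bij_betw_def dest: inj_onD)
      then show "x = y"
        unfolding x y cls_eq_iff .
    qed
    show "ult_map h ` classes (\<lambda>i. univ (M i)) = classes (\<lambda>i. univ (N i))"
    proof (intro set_eqI iffI)
      fix y assume "y \<in> ult_map h ` classes (\<lambda>i. univ (M i))"
      then obtain g where y: "y = ult_map h (cls g)" and g: "eventually (\<lambda>i. g i \<in> univ (M i)) U"
        by (auto elim: classesE)
      have "eventually (\<lambda>i. h i (g i) \<in> univ (N i)) U"
        using bij g by eventually_elim (auto simp: bij_betw_def)
      then show "y \<in> classes (\<lambda>i. univ (N i))"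
        by (simp add: y ult_map_cls cls_in_classes)
    next
      fix y assume "y \<in> classes (\<lambda>i. univ (N i))"
      then obtain k where y: "y = cls k" and k: "eventually (\<lambda>i. k i \<in> univ (N i)) U"
        by (rule classesE)
      let ?g = "\<lambda>i. inv_into (univ (M i)) (h i) (k i)"
      have "eventually (\<lambda>i. ?g i \<in> univ (M i)) U"
        using bij k by eventually_elim (auto simp: bij_betw_def inv_into_into)
      moreover have "eventually (\<lambda>i. h i (?g i) = k i) U"
        using bij k by eventually_elim (auto simp: bij_betw_def f_inv_into_f)
      ultimately show "y \<in> ult_map h ` classes (\<lambda>i. univ (M i))"
        by (intro image_eqI[of _ _ "cls ?g"]) (simp_all add: y ult_map_cls cls_eq_iff cls_in_classes
            eventually_mono)
    qed
  qed
  have map_tup: "map (ult_map h) xs \<in> tuples n (univ (ult Sig N))"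
    if "xs \<in> tuples n (univ (ult Sig M))" for n xs
    using that bij_ult by (intro map_tuples) (auto simp: bij_betw_def)
  show ?thesis
    unfolding struct_iso_def
  proof (intro conjI ballI bij_ult struct_on_ult M N)
    fix f xs assume f: "f \<in> fsyms Sig" and xs: "xs \<in> tuples (farity Sig f) (univ (ult Sig M))"
    have "eventually (\<lambda>i. coords xs i \<in> tuples (farity Sig f) (univ (M i))) U"
      using xs by (intro ev_coords_tuples) simp
    then have "eventually (\<lambda>i. h i (fint (M i) f (coords xs i))
        = fint (N i) f (coords (map (ult_map h) xs) i)) U"
      using iso coords[of xs] by eventually_elim (use f in \<open>simp add: struct_iso_def\<close>)
    then show "ult_map h (fint (ult Sig M) f xs) = fint (ult Sig N) f (map (ult_map h) xs)"
      by (simp only: fint_ult[OF f xs] fint_ult[OF f map_tup[OF xs]] ult_map_cls cls_eq_iff)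
  next
    fix R xs assume R: "R \<in> rsyms Sig" and xs: "xs \<in> tuples (rarity Sig R) (univ (ult Sig M))"
    have "eventually (\<lambda>i. coords xs i \<in> tuples (rarity Sig R) (univ (M i))) U"
      using xs by (intro ev_coords_tuples) simp
    then have "eventually (\<lambda>i. coords xs i \<in> rint (M i) R
        \<longleftrightarrow> coords (map (ult_map h) xs) i \<in> rint (N i) R) U"
      using iso coords[of xs] by eventually_elim (use R in \<open>simp add: struct_iso_def\<close>)
    then show "xs \<in> rint (ult Sig M) R \<longleftrightarrow> map (ult_map h) xs \<in> rint (ult Sig N) R"
      unfolding rint_ult[OF R xs] rint_ult[OF R map_tup[OF xs]] by (rule eventually_subst)
  qed
qed

lemma substruct_ult:
  assumes sub: "eventually (\<lambda>i. substruct Sig (M i) (N i)) U"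
  shows "substruct Sig (ult Sig M) (ult Sig N)"
proof -
  have M: "eventually (\<lambda>i. struct_on Sig (M i)) U" and N: "eventually (\<lambda>i. struct_on Sig (N i)) U"
    using sub by (auto simp: substruct_def elim: eventually_mono)
  have subset: "univ (ult Sig M) \<subseteq> univ (ult Sig N)"
    unfolding univ_ult
  proof (rule subsetI, erule classesE)
    fix x g assume x: "x = cls g" and g: "eventually (\<lambda>i. g i \<in> univ (M i)) U"
    show "x \<in> classes (\<lambda>i. univ (N i))"
      unfolding x cls_in_classes using sub g by eventually_elim (use substruct_subset in blast)
  qed
  show ?thesis
  proof (intro substructI struct_on_ult M N subset)
    fix f xs assume f: "f \<in> fsyms Sig" and xs: "xs \<in> tuples (farity Sig f) (univ (ult Sig M))"
    have "eventually (\<lambda>i. coords xs i \<in> tuples (farity Sig f) (univ (M i))) U"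
      using xs by (intro ev_coords_tuples) simp
    then have "eventually (\<lambda>i. fint (M i) f (coords xs i) = fint (N i) f (coords xs i)) U"
      using sub by eventually_elim (rule substruct_fint[OF _ f])
    then show "fint (ult Sig M) f xs = fint (ult Sig N) f xs"
      by (simp only: fint_ult[OF f xs] fint_ult[OF f tuples_mono[OF subset xs]] cls_eq_iff)
  next
    fix R xs assume R: "R \<in> rsyms Sig" and xs: "xs \<in> tuples (rarity Sig R) (univ (ult Sig M))"
    have "eventually (\<lambda>i. coords xs i \<in> tuples (rarity Sig R) (univ (M i))) U"
      using xs by (intro ev_coords_tuples) simp
    then have "eventually (\<lambda>i. coords xs i \<in> rint (M i) R \<longleftrightarrow> coords xs i \<in> rint (N i) R) U"
      using sub by eventually_elim (rule substruct_rint[OF _ R])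
    then show "xs \<in> rint (ult Sig M) R \<longleftrightarrow> xs \<in> rint (ult Sig N) R"
      unfolding rint_ult[OF R xs] rint_ult[OF R tuples_mono[OF subset xs]]
      by (rule eventually_subst)
  qed
qed

text \<open>
  This places the base of a type inside ultraproducts. A tuple of elements of \<open>M\<close> lies in \<open>A i\<close> for
  almost all \<open>i\<close>, where \<open>M\<close> and \<open>N i\<close> agree about it, and a value in \<open>M\<close> that is constant in \<open>i\<close>
  represents its own class.
\<close>

lemma substruct_of_ult:
  assumes M: "struct_on Sig M" and const: "\<And>x. x \<in> univ M \<Longrightarrow> cls (\<lambda>_. x) = x"
    and sub: "eventually (\<lambda>i. substruct Sig (A i) M \<and> substruct Sig (A i) (N i)) U"
    and mem: "\<And>x. x \<in> univ M \<Longrightarrow> eventually (\<lambda>i. x \<in> univ (A i)) U"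
  shows "substruct Sig M (ult Sig N)"
proof -
  have N: "eventually (\<lambda>i. struct_on Sig (N i)) U"
    using sub by (auto simp: substruct_def elim: eventually_mono)
  have subset: "univ M \<subseteq> univ (ult Sig N)"
  proof
    fix x assume x: "x \<in> univ M"
    have "eventually (\<lambda>i. x \<in> univ (N i)) U"
      using mem[OF x] sub by eventually_elim (use substruct_subset in blast)
    then show "x \<in> univ (ult Sig N)"
      using const[OF x] cls_in_classes[of "\<lambda>_. x"] by simp
  qed
  have coords: "eventually (\<lambda>i. coords xs i = xs \<and> xs \<in> tuples n (univ (A i))) U"
    if xs: "xs \<in> tuples n (univ M)" for n xs
  proof -
    have "map (\<lambda>x. cls (\<lambda>_. x)) xs = xs"
      using xs const by (intro map_idI) (auto simp: tuples_def)
    then have "eventually (\<lambda>i. coords xs i = xs) U"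
      using ev_coords_map[of "\<lambda>x _. x" xs] by simp
    moreover have "eventually (\<lambda>i. \<forall>x\<in>set xs. x \<in> univ (A i)) U"
      using xs mem by (intro eventually_ball_finite) (auto simp: tuples_def)
    then have "eventually (\<lambda>i. xs \<in> tuples n (univ (A i))) U"
      using xs by (auto simp: tuples_def elim: eventually_mono)
    ultimately show ?thesis
      by (rule eventually_conj)
  qed
  show ?thesis
  proof (intro substructI struct_on_ult M N subset)
    fix f xs assume f: "f \<in> fsyms Sig" and xs: "xs \<in> tuples (farity Sig f) (univ M)"
    have "eventually (\<lambda>i. fint (N i) f (coords xs i) = fint M f xs) U"
      using coords[OF xs] sub by eventually_elim (use substruct_fint[OF _ f] in metis)
    then have "fint (ult Sig N) f xs = cls (\<lambda>_. fint M f xs)"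
      by (simp only: fint_ult[OF f tuples_mono[OF subset xs]] cls_eq_iff)
    then show "fint M f xs = fint (ult Sig N) f xs"
      using const struct_fint_closed[OF M f xs] by simp
  next
    fix R xs assume R: "R \<in> rsyms Sig" and xs: "xs \<in> tuples (rarity Sig R) (univ M)"
    have "eventually (\<lambda>i. xs \<in> rint M R \<longleftrightarrow> coords xs i \<in> rint (N i) R) U"
      using coords[OF xs] sub by eventually_elim (use substruct_rint[OF _ R] in metis)
    then have "eventually (\<lambda>i. xs \<in> rint M R) U \<longleftrightarrow> eventually (\<lambda>i. coords xs i \<in> rint (N i) R) U"
      by (rule eventually_subst)
    then show "xs \<in> rint M R \<longleftrightarrow> xs \<in> rint (ult Sig N) R"
      using ultra unfolding rint_ult[OF R tuples_mono[OF subset xs]] by (simp add: ultrafilter_def)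
  qed
qed

end

section \<open>Ultraproducts in abstract elementary classes\<close>

lemma card_of_Times_ordLeq_infinite:
  "infinite T \<Longrightarrow> |A| \<le>o |T| \<Longrightarrow> |B| \<le>o |T| \<Longrightarrow> |A \<times> B| \<le>o |T|"
  by (simp add: card_of_Sigma_ordLeq_infinite)

lemma card_of_lists_ordLeq:
  assumes T: "infinite T"
  shows "|{xs. set xs \<subseteq> T}| \<le>o |T|"
proof -
  have len: "|{xs. length xs = n \<and> set xs \<subseteq> T}| \<le>o |T|" for n
  proof (induction n)
    case 0
    have "{xs. length xs = 0 \<and> set xs \<subseteq> T} = {[]}"
      by auto
    moreover have "T \<noteq> {}"
      using T by auto
    ultimately show ?case
      by (simp add: card_of_singl_ordLeq)
  next
    case (Suc n)
    let ?L = "{xs. length xs = n \<and> set xs \<subseteq> T}"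
    have "{xs. length xs = Suc n \<and> set xs \<subseteq> T} \<subseteq> (\<lambda>(x, xs). x # xs) ` (T \<times> ?L)"
      by (auto simp: length_Suc_conv image_iff)
    then have "|{xs. length xs = Suc n \<and> set xs \<subseteq> T}| \<le>o |(\<lambda>(x, xs). x # xs) ` (T \<times> ?L)|"
      by (rule card_of_mono1)
    also have "|(\<lambda>(x, xs). x # xs) ` (T \<times> ?L)| \<le>o |T \<times> ?L|"
      by (rule card_of_image)
    also have "|T \<times> ?L| \<le>o |T|"
      by (intro card_of_Times_ordLeq_infinite T Suc card_of_mono1 order_refl)
    finally show ?case .
  qed
  have "{xs. set xs \<subseteq> T} = (\<Union>n\<in>(UNIV :: nat set). {xs. length xs = n \<and> set xs \<subseteq> T})"
    by auto
  also have "|\<dots>| \<le>o |T|"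
    using T len by (intro card_of_UNION_ordLeq_infinite) (auto simp: infinite_iff_card_of_nat)
  finally show ?thesis .
qed

locale complete_ultraproduct = aec Sig K le + ultraproduct U cls
  for Sig :: "'v::zfc_universe signature" and K le and U :: "'v filter" and cls +
  fixes \<mu> :: "'v rel"
  assumes complete: "complete_filter \<mu> U" and LS_less: "LS Sig K le <o \<mu>"
begin

abbreviation T :: "'v set" where
  "T \<equiv> Field (LS Sig K le)"

lemma T_LS: "|T| =o LS Sig K le"
  using LS_cardinal by (simp add: cardinal_def card_of_Field_ordIso)

lemma ev_ex: "eventually P U \<Longrightarrow> \<exists>i. P i"
  using ultra eventually_happens by (auto simp: ultrafilter_def)

lemma ev_Ball:
  assumes "|B| \<le>o |T|" "\<And>b. b \<in> B \<Longrightarrow> eventually (P b) U"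
  shows "eventually (\<lambda>i. \<forall>b\<in>B. P b i) U"
proof -
  let ?S = "(\<lambda>b. {i. P b i}) ` B"
  have "|?S| \<le>o |B|"
    by (rule card_of_image)
  also note assms(1)
  also note ordIso_imp_ordLeq[OF T_LS]
  also note LS_less
  finally have "eventually (\<lambda>i. i \<in> \<Inter>?S) U"
    using complete assms(2) by (auto simp: complete_filter_def)
  then show ?thesis
    by simp
qed

text \<open>
  Each single statement is decided by the ultrafilter, so the indices at which it has the truth value
  chosen by \<open>U\<close> form a member of \<open>U\<close>; completeness intersects these members.
\<close>

lemma ev_decided:
  assumes "|B| \<le>o |T|"
  shows "eventually (\<lambda>i. \<forall>b\<in>B. P b i \<longleftrightarrow> eventually (P b) U) U"
proof (rule ev_Ball[OF assms])
  fix b assume "b \<in> B"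
  have "eventually (P b) U \<or> eventually (\<lambda>i. \<not> P b i) U"
    using ultra unfolding ultrafilter_def by (elim conjE allE[of _ "{i. P b i}"]) simp
  then show "eventually (\<lambda>i. P b i \<longleftrightarrow> eventually (P b) U) U"
    by (cases "eventually (P b) U") auto
qed

lemma ev_Bex:
  assumes "|B| \<le>o |T|" "eventually (\<lambda>i. \<exists>b\<in>B. P b i) U"
  shows "\<exists>b\<in>B. eventually (P b) U"
proof -
  have "\<exists>i. (\<exists>b\<in>B. P b i) \<and> (\<forall>b\<in>B. P b i \<longleftrightarrow> eventually (P b) U)"
    by (intro ev_ex eventually_conj assms ev_decided)
  then show ?thesis
    by blast
qed

text \<open>
  Enumerate each \<open>C i\<close> by \<open>e i\<close> along the set \<open>T\<close> of size \<open>LS(K)\<close>. The atomic facts about the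
  enumerations, indexed by elements and finite lists of elements of \<open>T\<close>, are so few that at some
  index \<open>i0\<close> all of them hold exactly if they hold almost everywhere. Then sending \<open>e i0 t\<close> to the
  class of \<open>\<lambda>i. e i t\<close> is an isomorphism of \<open>C i0\<close> onto the ultraproduct, and it maps \<open>A i0\<close> onto
  the ultraproduct of the \<open>A i\<close>. It is surjective because \<open>g i \<in> C i\<close> means \<open>g i = e i t\<close> for some
  \<open>t\<close> depending on \<open>i\<close>, and by completeness one \<open>t\<close> works almost everywhere. Closure under
  isomorphism carries \<open>(A i0, C i0) \<in> le\<close> over to the ultraproducts.
\<close>

lemma ult_small_le:
  assumes AC: "eventually (\<lambda>i. (A i, C i) \<in> le \<and> |univ (C i)| \<le>o LS Sig K le) U"
  shows "(ult Sig A, ult Sig C) \<in> le"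
proof -
  have "\<exists>e. |univ (C i)| \<le>o LS Sig K le \<longrightarrow> univ (C i) \<subseteq> e ` T" for i
  proof (cases "univ (C i) = {}")
    case False
    have "\<exists>e. e ` T = univ (C i)" if "|univ (C i)| \<le>o LS Sig K le"
      using ordLeq_ordIso_trans[OF that ordIso_symmetric[OF T_LS]] card_of_ordLeq2[OF False, of T]
      by blast
    then show ?thesis
      by blast
  qed simp
  then obtain e where e: "\<And>i. |univ (C i)| \<le>o LS Sig K le \<Longrightarrow> univ (C i) \<subseteq> e i ` T"
    by metis
  have T: "infinite T" "|T| \<le>o |T|"
    by (rule LS_infinite) (rule card_of_mono1[OF order_refl])
  let ?L = "{ss. set ss \<subseteq> T}"
  have L: "|?L| \<le>o |T|"
    by (rule card_of_lists_ordLeq[OF T(1)])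
  have syms: "|fsyms Sig| \<le>o |T|" "|rsyms Sig| \<le>o |T|"
  proof -
    have "|fsyms Sig <+> rsyms Sig| \<le>o |T|"
      using LS_signature T_LS ordLeq_ordIso_trans ordIso_symmetric by blast
    then show "|fsyms Sig| \<le>o |T|" "|rsyms Sig| \<le>o |T|"
      using card_of_Plus1 card_of_Plus2 ordLeq_transitive by blast+
  qed
  note dec = ev_decided[where B = "T \<times> T" and P = "\<lambda>(s, t) i. e i s = e i t"]
    ev_decided[where B = T and P = "\<lambda>t i. e i t \<in> univ (C i)"]
    ev_decided[where B = T and P = "\<lambda>t i. e i t \<in> univ (A i)"]
    ev_decided[where B = "fsyms Sig \<times> ?L \<times> T"
      and P = "\<lambda>(f, ss, t) i. fint (C i) f (map (e i) ss) = e i t"]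
    ev_decided[where B = "rsyms Sig \<times> ?L" and P = "\<lambda>(R, ss) i. map (e i) ss \<in> rint (C i) R"]
  obtain i0 where AC_o: "(A i0, C i0) \<in> le" "|univ (C i0)| \<le>o LS Sig K le"
    and eq_dec: "\<And>s t. s \<in> T \<Longrightarrow> t \<in> T \<Longrightarrow> e i0 s = e i0 t \<longleftrightarrow> eventually (\<lambda>i. e i s = e i t) U"
    and C_dec: "\<And>t. t \<in> T \<Longrightarrow> e i0 t \<in> univ (C i0) \<longleftrightarrow> eventually (\<lambda>i. e i t \<in> univ (C i)) U"
    and A_dec: "\<And>t. t \<in> T \<Longrightarrow> e i0 t \<in> univ (A i0) \<longleftrightarrow> eventually (\<lambda>i. e i t \<in> univ (A i)) U"
    and f_dec: "\<And>f ss t. f \<in> fsyms Sig \<Longrightarrow> set ss \<subseteq> T \<Longrightarrow> t \<in> T \<Longrightarrow>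
      fint (C i0) f (map (e i0) ss) = e i0 t \<longleftrightarrow> eventually (\<lambda>i. fint (C i) f (map (e i) ss) = e i t) U"
    and R_dec: "\<And>R ss. R \<in> rsyms Sig \<Longrightarrow> set ss \<subseteq> T \<Longrightarrow>
      map (e i0) ss \<in> rint (C i0) R \<longleftrightarrow> eventually (\<lambda>i. map (e i) ss \<in> rint (C i) R) U"
  proof -
    have "\<exists>i. ((A i, C i) \<in> le \<and> |univ (C i)| \<le>o LS Sig K le)
      \<and> (\<forall>b\<in>T \<times> T. (case b of (s, t) \<Rightarrow> \<lambda>i. e i s = e i t) i
          \<longleftrightarrow> eventually (case b of (s, t) \<Rightarrow> \<lambda>i. e i s = e i t) U)
      \<and> (\<forall>t\<in>T. e i t \<in> univ (C i) \<longleftrightarrow> eventually (\<lambda>i. e i t \<in> univ (C i)) U)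
      \<and> (\<forall>t\<in>T. e i t \<in> univ (A i) \<longleftrightarrow> eventually (\<lambda>i. e i t \<in> univ (A i)) U)
      \<and> (\<forall>b\<in>fsyms Sig \<times> ?L \<times> T.
          (case b of (f, ss, t) \<Rightarrow> \<lambda>i. fint (C i) f (map (e i) ss) = e i t) i
          \<longleftrightarrow> eventually (case b of (f, ss, t) \<Rightarrow> \<lambda>i. fint (C i) f (map (e i) ss) = e i t) U)
      \<and> (\<forall>b\<in>rsyms Sig \<times> ?L. (case b of (R, ss) \<Rightarrow> \<lambda>i. map (e i) ss \<in> rint (C i) R) i
          \<longleftrightarrow> eventually (case b of (R, ss) \<Rightarrow> \<lambda>i. map (e i) ss \<in> rint (C i) R) U)"
      by (intro ev_ex eventually_conj AC dec card_of_Times_ordLeq_infinite T L syms)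
    then obtain i0 where "(A i0, C i0) \<in> le \<and> |univ (C i0)| \<le>o LS Sig K le"
      and *: "\<forall>b\<in>T \<times> T. (case b of (s, t) \<Rightarrow> \<lambda>i. e i s = e i t) i0
          \<longleftrightarrow> eventually (case b of (s, t) \<Rightarrow> \<lambda>i. e i s = e i t) U"
      "\<forall>t\<in>T. e i0 t \<in> univ (C i0) \<longleftrightarrow> eventually (\<lambda>i. e i t \<in> univ (C i)) U"
      "\<forall>t\<in>T. e i0 t \<in> univ (A i0) \<longleftrightarrow> eventually (\<lambda>i. e i t \<in> univ (A i)) U"
      "\<forall>b\<in>fsyms Sig \<times> ?L \<times> T.
          (case b of (f, ss, t) \<Rightarrow> \<lambda>i. fint (C i) f (map (e i) ss) = e i t) i0
          \<longleftrightarrow> eventually (case b of (f, ss, t) \<Rightarrow> \<lambda>i. fint (C i) f (map (e i) ss) = e i t) U"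
      "\<forall>b\<in>rsyms Sig \<times> ?L. (case b of (R, ss) \<Rightarrow> \<lambda>i. map (e i) ss \<in> rint (C i) R) i0
          \<longleftrightarrow> eventually (case b of (R, ss) \<Rightarrow> \<lambda>i. map (e i) ss \<in> rint (C i) R) U"
      by (elim exE conjE) (rule that, simp)
    then show thesis
      using *(1)[rule_format, of "(_, _)"] *(4)[rule_format, of "(_, _, _)"]
        *(5)[rule_format, of "(_, _)"]
      by (intro that[of i0]) simp_all
  qed
  have Co: "univ (C i0) \<subseteq> e i0 ` T"
    by (rule e[OF AC_o(2)])
  have Ao: "univ (A i0) \<subseteq> e i0 ` T"
    using le_subset[OF AC_o(1)] Co by blast
  have evC: "eventually (\<lambda>i. univ (C i) \<subseteq> e i ` T) U"
    using AC by (rule eventually_mono) (simp add: e)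
  have evA: "eventually (\<lambda>i. univ (A i) \<subseteq> e i ` T) U"
    using AC evC by eventually_elim (use le_subset in blast)
  define k where "k x = (SOME t. t \<in> T \<and> e i0 t = x)" for x
  define h where "h x = cls (\<lambda>i. e i (k x))" for x
  have k: "k x \<in> T \<and> e i0 (k x) = x" if "x \<in> e i0 ` T" for x
    unfolding k_def by (rule someI_ex[of "\<lambda>t. t \<in> T \<and> e i0 t = x"]) (use that in auto)
  have h_e: "h (e i0 t) = cls (\<lambda>i. e i t)" if "t \<in> T" for t
    using k[of "e i0 t"] that eq_dec[of "k (e i0 t)" t] by (simp add: h_def cls_eq_iff)
  \<comment> \<open>Applied to the universes of \<open>C\<close> and of \<open>A\<close>.\<close>
  have h_image: "h ` X i0 = classes X" if Xo: "X i0 \<subseteq> e i0 ` T" and evX: "eventually (\<lambda>i. X i \<subseteq> e i ` T) U"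
    and X_dec: "\<And>t. t \<in> T \<Longrightarrow> e i0 t \<in> X i0 \<longleftrightarrow> eventually (\<lambda>i. e i t \<in> X i) U" for X
  proof (intro set_eqI iffI)
    fix y assume "y \<in> h ` X i0"
    then obtain t where "t \<in> T" "e i0 t \<in> X i0" "y = h (e i0 t)"
      using Xo by auto
    then show "y \<in> classes X"
      using X_dec[of t] by (simp add: h_e cls_in_classes)
  next
    fix y assume "y \<in> classes X"
    then obtain g where y: "y = cls g" and g: "eventually (\<lambda>i. g i \<in> X i) U"
      by (rule classesE)
    have "eventually (\<lambda>i. \<exists>t\<in>T. g i = e i t) U"
      using g evX by eventually_elim blast
    then obtain t where t: "t \<in> T" "eventually (\<lambda>i. g i = e i t) U"
      using ev_Bex[OF T(2), of "\<lambda>t i. g i = e i t"] by blast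
    have "eventually (\<lambda>i. e i t \<in> X i) U"
      using g t(2) by eventually_elim simp
    then have "e i0 t \<in> X i0"
      using X_dec[OF t(1)] by simp
    moreover have "y = h (e i0 t)"
      using t by (simp add: y h_e cls_eq_iff)
    ultimately show "y \<in> h ` X i0"
      by blast
  qed
  have hC: "h ` univ (C i0) = univ (ult Sig C)"
    unfolding univ_ult by (rule h_image[of "\<lambda>i. univ (C i)", OF Co evC C_dec])
  have hA: "h ` univ (A i0) = univ (ult Sig A)"
    unfolding univ_ult by (rule h_image[of "\<lambda>i. univ (A i)", OF Ao evA A_dec])
  have C_struct: "struct_on Sig (C i0)"
    using AC_o(1) by (intro K_struct le_K)
  have "eventually (\<lambda>i. struct_on Sig (C i)) U"
    using AC by (rule eventually_mono) (blast intro: K_struct le_K)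
  then have ultC: "struct_on Sig (ult Sig C)"
    by (rule struct_on_ult)
  have iso: "struct_iso Sig h (C i0) (ult Sig C)"
    unfolding struct_iso_def
  proof (intro conjI ballI C_struct ultC)
    have "inj_on h (univ (C i0))"
    proof (rule inj_onI)
      fix x y assume xy: "x \<in> univ (C i0)" "y \<in> univ (C i0)" "h x = h y"
      obtain s where "s \<in> T" "x = e i0 s"
        using Co xy(1) by blast
      moreover obtain t where "t \<in> T" "y = e i0 t"
        using Co xy(2) by blast
      moreover note xy(3)
      ultimately show "x = y"
        using eq_dec[of s t] by (simp add: h_e cls_eq_iff)
    qed
    then show "bij_betw h (univ (C i0)) (univ (ult Sig C))"
      using hC by (simp add: bij_betw_def)
  next
    fix f xs assume f: "f \<in> fsyms Sig" and xs: "xs \<in> tuples (farity Sig f) (univ (C i0))"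
    obtain ss where "xs = map (e i0) ss" "ss \<in> tuples (farity Sig f) T"
      by (rule tuples_imageE[OF tuples_mono[OF Co xs]])
    then have ss: "xs = map (e i0) ss" "set ss \<subseteq> T"
      by (simp_all add: tuples_def)
    have "fint (C i0) f xs \<in> univ (C i0)"
      by (rule struct_fint_closed[OF C_struct f xs])
    then obtain t where t: "t \<in> T" "fint (C i0) f xs = e i0 t"
      using Co by blast
    have hxs: "map h xs = map (\<lambda>s. cls (\<lambda>i. e i s)) ss"
      using ss(2) h_e by (auto simp: ss(1))
    have "eventually (\<lambda>i. fint (C i) f (map (e i) ss) = e i t) U"
      using f_dec[OF f ss(2) t(1)] t(2) ss(1) by simp
    moreover have "eventually (\<lambda>i. coords (map h xs) i = map (e i) ss) U"
      unfolding hxs by (rule ev_coords_map)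
    ultimately have "eventually (\<lambda>i. fint (C i) f (coords (map h xs) i) = e i t) U"
      by eventually_elim simp
    moreover have "map h xs \<in> tuples (farity Sig f) (univ (ult Sig C))"
      using hC by (intro map_tuples[OF xs]) simp
    ultimately show "h (fint (C i0) f xs) = fint (ult Sig C) f (map h xs)"
      using t by (simp only: fint_ult[OF f] h_e cls_eq_iff) (auto elim: eventually_mono)
  next
    fix R xs assume R: "R \<in> rsyms Sig" and xs: "xs \<in> tuples (rarity Sig R) (univ (C i0))"
    obtain ss where "xs = map (e i0) ss" "ss \<in> tuples (rarity Sig R) T"
      by (rule tuples_imageE[OF tuples_mono[OF Co xs]])
    then have ss: "xs = map (e i0) ss" "set ss \<subseteq> T"
      by (simp_all add: tuples_def)
    have hxs: "map h xs = map (\<lambda>s. cls (\<lambda>i. e i s)) ss"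
      using ss(2) h_e by (auto simp: ss(1))
    have "eventually (\<lambda>i. coords (map h xs) i = map (e i) ss) U"
      unfolding hxs by (rule ev_coords_map)
    then have "eventually (\<lambda>i. map (e i) ss \<in> rint (C i) R \<longleftrightarrow> coords (map h xs) i \<in> rint (C i) R) U"
      by eventually_elim simp
    then have "eventually (\<lambda>i. map (e i) ss \<in> rint (C i) R) U
        \<longleftrightarrow> eventually (\<lambda>i. coords (map h xs) i \<in> rint (C i) R) U"
      by (rule eventually_subst)
    moreover have "map h xs \<in> tuples (rarity Sig R) (univ (ult Sig C))"
      using hC by (intro map_tuples[OF xs]) simp
    ultimately show "xs \<in> rint (C i0) R \<longleftrightarrow> map h xs \<in> rint (ult Sig C) R"
      using R_dec[OF R ss(2)] by (simp only: rint_ult[OF R] ss(1))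
  qed
  have "eventually (\<lambda>i. substruct Sig (A i) (C i)) U"
    using AC by (rule eventually_mono) (simp add: le_substruct)
  then have "struct_iso Sig h (A i0) (ult Sig A)"
    using struct_iso_restrict[OF iso le_substruct[OF AC_o(1)] substruct_ult hA] by blast
  then show ?thesis
    using iso_le[OF AC_o(1) iso] by blast
qed

lemma LS_down_small:
  assumes "N \<in> K" "X \<subseteq> univ N" "|X| \<le>o LS Sig K le"
  shows "\<exists>A. (A, N) \<in> le \<and> X \<subseteq> univ A \<and> |univ A| \<le>o LS Sig K le"
  using LS_down[OF assms ordLeq_refl] LS_cardinal by (metis cardinal_def)

lemma finite_le_LS: "finite X \<Longrightarrow> |X| \<le>o LS Sig K le"
  using finite_ordLess_infinite[OF card_of_Well_order[of X] card_of_Well_order[of T]] LS_infinite T_LS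
  by (auto simp: Field_card_of intro: ordLeq_ordIso_trans ordLess_imp_ordLeq)

text \<open>
  The ultraproducts of strong substructures \<open>A i\<close> of size at most \<open>LS(K)\<close> form a directed family,
  since two such choices of substructures have an upper bound at each index by the
  Loewenheim--Skolem axiom and coherence; they cover the ultraproduct because singletons have upper
  bounds as well. So closure under directed unions lifts the case of small factors to all factors.
\<close>

lemma ult_directed:
  assumes N: "eventually (\<lambda>i. N i \<in> K) U"
  shows "ult Sig N \<in> K"
    and "eventually (\<lambda>i. (A i, N i) \<in> le \<and> |univ (A i)| \<le>o LS Sig K le) U \<Longrightarrow>
      (ult Sig A, ult Sig N) \<in> le"
    and "(\<And>A. eventually (\<lambda>i. (A i, N i) \<in> le \<and> |univ (A i)| \<le>o LS Sig K le) U \<Longrightarrow>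
      (ult Sig A, L) \<in> le) \<Longrightarrow> (ult Sig N, L) \<in> le"
proof -
  let ?sm = "\<lambda>A. eventually (\<lambda>i. (A i, N i) \<in> le \<and> |univ (A i)| \<le>o LS Sig K le) U"
  let ?D = "{ult Sig A | A. ?sm A}"
  have small_above: "\<exists>A. ?sm A \<and> eventually (\<lambda>i. X i \<subseteq> univ (A i)) U"
    if X: "eventually (\<lambda>i. X i \<subseteq> univ (N i) \<and> |X i| \<le>o LS Sig K le) U" for X
  proof -
    have "\<forall>i. \<exists>A. N i \<in> K \<longrightarrow> X i \<subseteq> univ (N i) \<and> |X i| \<le>o LS Sig K le \<longrightarrow>
        (A, N i) \<in> le \<and> X i \<subseteq> univ A \<and> |univ A| \<le>o LS Sig K le"
      using LS_down_small by blast
    then obtain A where A: "\<And>i. N i \<in> K \<Longrightarrow> X i \<subseteq> univ (N i) \<Longrightarrow> |X i| \<le>o LS Sig K le \<Longrightarrow>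
        (A i, N i) \<in> le \<and> X i \<subseteq> univ (A i) \<and> |univ (A i)| \<le>o LS Sig K le"
      by metis
    have "?sm A" "eventually (\<lambda>i. X i \<subseteq> univ (A i)) U"
      using N X by (eventually_elim, use A in blast)+
    then show ?thesis
      by blast
  qed
  have st: "struct_on Sig (ult Sig N)"
    using N by (intro struct_on_ult) (auto elim: eventually_mono intro: K_struct)
  have ne: "?D \<noteq> {}"
    using small_above[of "\<lambda>_. {}"] by (auto simp: finite_le_LS)
  have sub: "\<forall>B\<in>?D. B \<in> K \<and> substruct Sig B (ult Sig N)"
  proof
    fix B assume "B \<in> ?D"
    then obtain A where B: "B = ult Sig A" and A: "?sm A"
      by blast
    have "eventually (\<lambda>i. (A i, A i) \<in> le \<and> |univ (A i)| \<le>o LS Sig K le) U"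
      using A by (rule eventually_mono) (blast intro: le_refl le_K)
    then have "B \<in> K"
      unfolding B using ult_small_le le_K(1) by blast
    moreover have "eventually (\<lambda>i. substruct Sig (A i) (N i)) U"
      using A by (rule eventually_mono) (blast intro: le_substruct)
    ultimately show "B \<in> K \<and> substruct Sig B (ult Sig N)"
      unfolding B using substruct_ult by blast
  qed
  have dir: "\<forall>B1\<in>?D. \<forall>B2\<in>?D. \<exists>C\<in>?D. (B1, C) \<in> le \<and> (B2, C) \<in> le"
  proof (intro ballI)
    fix B1 B2 assume "B1 \<in> ?D" "B2 \<in> ?D"
    then obtain A1 A2 where B: "B1 = ult Sig A1" "B2 = ult Sig A2" and A: "?sm A1" "?sm A2"
      by blast
    have "eventually (\<lambda>i. univ (A1 i) \<union> univ (A2 i) \<subseteq> univ (N i)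
        \<and> |univ (A1 i) \<union> univ (A2 i)| \<le>o LS Sig K le) U"
      using A
    proof eventually_elim
      case (elim i)
      then show ?case
        using le_subset[of "A1 i" "N i"] le_subset[of "A2 i" "N i"] LS_infinite LS_cardinal
        by (auto intro!: card_of_Un_ordLeq_infinite_Field simp: cardinal_def)
    qed
    from small_above[OF this] obtain C where
      C: "?sm C" "eventually (\<lambda>i. univ (A1 i) \<union> univ (A2 i) \<subseteq> univ (C i)) U"
      by blast
    have "eventually (\<lambda>i. (A1 i, C i) \<in> le \<and> |univ (C i)| \<le>o LS Sig K le) U"
      using A(1) C by eventually_elim (blast intro: coherence)
    moreover have "eventually (\<lambda>i. (A2 i, C i) \<in> le \<and> |univ (C i)| \<le>o LS Sig K le) U"
      using A(2) C by eventually_elim (blast intro: coherence)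
    ultimately have "(B1, ult Sig C) \<in> le" "(B2, ult Sig C) \<in> le"
      unfolding B by (auto intro: ult_small_le)
    then show "\<exists>C\<in>?D. (B1, C) \<in> le \<and> (B2, C) \<in> le"
      using C(1) by blast
  qed
  have cover: "univ (ult Sig N) \<subseteq> (\<Union>B\<in>?D. univ B)"
  proof
    fix x assume "x \<in> univ (ult Sig N)"
    then obtain g where x: "x = cls g" and "eventually (\<lambda>i. g i \<in> univ (N i)) U"
      by (auto elim: classesE)
    then have "eventually (\<lambda>i. {g i} \<subseteq> univ (N i) \<and> |{g i}| \<le>o LS Sig K le) U"
      by (auto simp: finite_le_LS)
    from small_above[OF this] obtain A where
      A: "?sm A" "eventually (\<lambda>i. {g i} \<subseteq> univ (A i)) U"
      by blast
    then have "x \<in> univ (ult Sig A)"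
      by (simp add: x cls_in_classes)
    then show "x \<in> (\<Union>B\<in>?D. univ B)"
      using A(1) by blast
  qed
  note union = directed_union[OF st ne sub dir cover]
  show "ult Sig N \<in> K"
    by (rule union(1))
  show "(ult Sig A, ult Sig N) \<in> le" if "?sm A"
  proof -
    have "ult Sig A \<in> ?D"
      using that by (intro CollectI exI[of _ A] conjI refl)
    then show ?thesis
      by (rule union(2))
  qed
  show "(ult Sig N, L) \<in> le" if L: "\<And>A. ?sm A \<Longrightarrow> (ult Sig A, L) \<in> le"
  proof (rule union(3))
    fix B assume "B \<in> ?D"
    then obtain A where "B = ult Sig A" "?sm A"
      by blast
    then show "(B, L) \<in> le"
      using L by simp
  qed
qed

text \<open>
  The small strong substructures of \<open>M i\<close> are among those of \<open>N i\<close>, so the directed family for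
  \<open>M\<close> consists of strong substructures of the ultraproduct of \<open>N\<close>, and smoothness applies.
\<close>

lemma ult_le:
  assumes "eventually (\<lambda>i. (M i, N i) \<in> le) U"
  shows "(ult Sig M, ult Sig N) \<in> le"
proof (rule ult_directed(3))
  show "eventually (\<lambda>i. M i \<in> K) U"
    using assms by (rule eventually_mono) (rule le_K)
  fix A assume "eventually (\<lambda>i. (A i, M i) \<in> le \<and> |univ (A i)| \<le>o LS Sig K le) U"
  then have "eventually (\<lambda>i. (A i, N i) \<in> le \<and> |univ (A i)| \<le>o LS Sig K le) U"
    using assms by eventually_elim (blast intro: le_trans)
  moreover have "eventually (\<lambda>i. N i \<in> K) U"
    using assms by (rule eventually_mono) (rule le_K)
  ultimately show "(ult Sig A, ult Sig N) \<in> le"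
    by (intro ult_directed(2))
qed

lemma ult_K_embedding:
  assumes "eventually (\<lambda>i. K_embedding Sig le (h i) (M i) (N i)) U"
  shows "K_embedding Sig le (ult_map h) (ult Sig M) (ult Sig N)"
proof -
  have "\<forall>i. \<exists>M'. K_embedding Sig le (h i) (M i) (N i) \<longrightarrow>
      struct_iso Sig (h i) (M i) M' \<and> (M', N i) \<in> le"
    by (auto simp: K_embedding_def)
  then obtain M' where M': "\<And>i. K_embedding Sig le (h i) (M i) (N i) \<Longrightarrow>
      struct_iso Sig (h i) (M i) (M' i) \<and> (M' i, N i) \<in> le"
    by metis
  have "eventually (\<lambda>i. struct_iso Sig (h i) (M i) (M' i)) U" "eventually (\<lambda>i. (M' i, N i) \<in> le) U"
    using assms by (eventually_elim, use M' in blast)+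
  note struct_iso_ult[OF this(1)] ult_le[OF this(2)]
  then show ?thesis
    unfolding K_embedding_def using le_substruct by blast
qed

text \<open>
  By completeness, a function into a structure of size at most \<open>LS(K)\<close> is constant almost everywhere.
  So such a structure equals its ultrapower when constants are represented by their values, and
  the general case follows by taking the union of such substructures.
\<close>

lemma le_ultrapower:
  assumes N: "N \<in> K" and const: "\<And>x. x \<in> univ N \<Longrightarrow> cls (\<lambda>_. x) = x"
  shows "(N, ult Sig (\<lambda>_. N)) \<in> le"
proof -
  let ?D = "{A. (A, N) \<in> le \<and> |univ A| \<le>o LS Sig K le}"
  have small_above: "\<exists>A\<in>?D. X \<subseteq> univ A" if "X \<subseteq> univ N" "|X| \<le>o LS Sig K le" for X
    using LS_down_small[OF N that] by blast
  have ne: "?D \<noteq> {}"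
    using small_above[of "{}"] finite_le_LS by auto
  have sub: "\<forall>A\<in>?D. A \<in> K \<and> substruct Sig A N"
    using le_K le_substruct by blast
  have dir: "\<forall>A\<in>?D. \<forall>B\<in>?D. \<exists>C\<in>?D. (A, C) \<in> le \<and> (B, C) \<in> le"
  proof (intro ballI)
    fix A B assume AB: "A \<in> ?D" "B \<in> ?D"
    have "univ A \<union> univ B \<subseteq> univ N" "|univ A \<union> univ B| \<le>o LS Sig K le"
      using AB le_subset[of A N] le_subset[of B N] LS_infinite LS_cardinal
      by (auto intro!: card_of_Un_ordLeq_infinite_Field simp: cardinal_def)
    from small_above[OF this] obtain C where "C \<in> ?D" "univ A \<union> univ B \<subseteq> univ C"
      by blast
    then show "\<exists>C\<in>?D. (A, C) \<in> le \<and> (B, C) \<in> le"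
      using AB by (intro bexI[of _ C]) (auto intro: coherence)
  qed
  have cover: "univ N \<subseteq> (\<Union>A\<in>?D. univ A)"
  proof
    fix x assume "x \<in> univ N"
    then obtain A where "A \<in> ?D" "{x} \<subseteq> univ A"
      using small_above[of "{x}"] finite_le_LS[of "{x}"] by auto
    then show "x \<in> (\<Union>A\<in>?D. univ A)"
      by blast
  qed
  show ?thesis
  proof (rule directed_union(3)[OF K_struct[OF N] ne sub dir cover])
    fix A assume A: "A \<in> ?D"
    then have AN: "(A, N) \<in> le" and AK: "A \<in> K" and constA: "\<And>x. x \<in> univ A \<Longrightarrow> cls (\<lambda>_. x) = x"
      using le_K le_subset const by blast+
    have "|univ A| \<le>o |T|"
      using A T_LS ordLeq_ordIso_trans ordIso_symmetric by blast
    have "substruct Sig A (ult Sig (\<lambda>_. N))"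
      using AN AK constA le_substruct[OF AN] le_substruct[OF le_refl[OF AK]]
      by (intro substruct_of_ult[where A = "\<lambda>_. A"] K_struct) auto
    moreover have "substruct Sig (ult Sig (\<lambda>_. A)) (ult Sig (\<lambda>_. N))"
      using AN by (intro substruct_ult) (simp add: le_substruct)
    moreover have "univ A = univ (ult Sig (\<lambda>_. A))"
    proof (intro set_eqI iffI)
      fix x assume "x \<in> univ A"
      then show "x \<in> univ (ult Sig (\<lambda>_. A))"
        using constA[of x] cls_in_classes[of "\<lambda>_. x" "\<lambda>_. univ A"] by simp
    next
      fix x assume "x \<in> univ (ult Sig (\<lambda>_. A))"
      then obtain g where x: "x = cls g" and "eventually (\<lambda>i. g i \<in> univ A) U"
        by (auto elim: classesE)
      then have "eventually (\<lambda>i. \<exists>b\<in>univ A. g i = b) U"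
        by simp
      then obtain b where "b \<in> univ A" "eventually (\<lambda>i. g i = b) U"
        using ev_Bex[OF \<open>|univ A| \<le>o |T|\<close>, of "\<lambda>b i. g i = b"] by blast
      then show "x \<in> univ A"
        using constA[of b] cls_eq_iff[of g "\<lambda>_. b"] by (simp add: x)
    qed
    ultimately have "A = ult Sig (\<lambda>_. A)"
      by (rule substruct_unique)
    moreover have "(ult Sig (\<lambda>_. A), ult Sig (\<lambda>_. N)) \<in> le"
      using AN by (intro ult_le) simp
    ultimately show "(A, ult Sig (\<lambda>_. N)) \<in> le"
      by simp
  qed
qed

end

section \<open>Equivalence of triples passes to ultraproducts\<close>

context complete_ultraproduct
begin

lemma atomic_equiv_ultrapower:
  assumes "(M, N) \<in> le" "a \<in> univ N" "\<And>x. x \<in> univ N \<Longrightarrow> cls (\<lambda>_. x) = x"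
  shows "((a, M, N), (a, M, ult Sig (\<lambda>_. N))) \<in> atomic_equiv Sig K le M"
proof -
  have N: "(N, ult Sig (\<lambda>_. N)) \<in> le"
    using assms(1,3) by (intro le_ultrapower le_K(2))
  then have emb: "K_embedding Sig le id N' (ult Sig (\<lambda>_. N))" if "(N', ult Sig (\<lambda>_. N)) \<in> le" for N'
    unfolding K_embedding_def using that struct_iso_id[OF K_struct[OF le_K(1)]] le_substruct by blast
  have "ult Sig (\<lambda>_. N) \<in> K"
    using N by (rule le_K)
  moreover have "K_embedding Sig le id N (ult Sig (\<lambda>_. N))"
    using N by (rule emb)
  moreover have "K_embedding Sig le id (ult Sig (\<lambda>_. N)) (ult Sig (\<lambda>_. N))"
    by (rule emb[OF le_refl]) fact
  moreover have "(M, ult Sig (\<lambda>_. N)) \<in> le" "a \<in> univ (ult Sig (\<lambda>_. N))"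
    using le_trans[OF assms(1) N] le_subset[OF N] assms(2) by auto
  ultimately show ?thesis
    using assms unfolding atomic_equiv_iff triples_over_def by blast
qed

text \<open>
  The ultraproduct of the amalgams amalgamates the ultraproducts. That \<open>M\<close> is
  strong in the second ultraproduct follows from its being strong in the first by coherence inside
  the amalgam, where the images of \<open>M\<close> under the two embeddings coincide. In this way strength of
  \<open>M\<close> is passed along a chain of atomic equivalences.
\<close>

lemma atomic_equiv_ult:
  assumes M: "(M, ult Sig (\<lambda>i. snd (snd (s i)))) \<in> le"
    and const: "\<And>x. x \<in> univ M \<Longrightarrow> cls (\<lambda>_. x) = x"
    and sub: "eventually (\<lambda>i. substruct Sig (B i) M) U"
    and mem: "\<And>x. x \<in> univ M \<Longrightarrow> eventually (\<lambda>i. x \<in> univ (B i)) U"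
    and st: "eventually (\<lambda>i. (s i, t i) \<in> atomic_equiv Sig K le (B i)) U"
  shows "((cls (\<lambda>i. fst (s i)), M, ult Sig (\<lambda>i. snd (snd (s i)))),
      (cls (\<lambda>i. fst (t i)), M, ult Sig (\<lambda>i. snd (snd (t i))))) \<in> atomic_equiv Sig K le M"
proof -
  define b N c N' where "b i = fst (s i)" and "N i = snd (snd (s i))"
    and "c i = fst (t i)" and "N' i = snd (snd (t i))" for i
  have "\<forall>i. \<exists>L f g. (s i, t i) \<in> atomic_equiv Sig K le (B i) \<longrightarrow>
      (B i, N i) \<in> le \<and> b i \<in> univ (N i) \<and> (B i, N' i) \<in> le \<and> c i \<in> univ (N' i) \<and> L \<in> K \<and>
      K_embedding Sig le f (N i) L \<and> K_embedding Sig le g (N' i) L \<and>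
      (\<forall>x\<in>univ (B i). f x = g x) \<and> f (b i) = g (c i)"
    by (auto simp: atomic_equiv_def triples_over_def b_def c_def N_def N'_def) blast
  then obtain L f g where *: "\<And>i. (s i, t i) \<in> atomic_equiv Sig K le (B i) \<Longrightarrow>
      (B i, N i) \<in> le \<and> b i \<in> univ (N i) \<and> (B i, N' i) \<in> le \<and> c i \<in> univ (N' i) \<and> L i \<in> K \<and>
      K_embedding Sig le (f i) (N i) (L i) \<and> K_embedding Sig le (g i) (N' i) (L i) \<and>
      (\<forall>x\<in>univ (B i). f i x = g i x) \<and> f i (b i) = g i (c i)"
    by metis
  have ev: "eventually (\<lambda>i. b i \<in> univ (N i)) U" "eventually (\<lambda>i. (B i, N' i) \<in> le) U"
    "eventually (\<lambda>i. c i \<in> univ (N' i)) U" "eventually (\<lambda>i. L i \<in> K) U"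
    "eventually (\<lambda>i. K_embedding Sig le (f i) (N i) (L i)) U"
    "eventually (\<lambda>i. K_embedding Sig le (g i) (N' i) (L i)) U"
    "eventually (\<lambda>i. \<forall>x\<in>univ (B i). f i x = g i x) U" "eventually (\<lambda>i. f i (b i) = g i (c i)) U"
    using st by (eventually_elim, use * in blast)+
  let ?F = "ult_map f" and ?G = "ult_map g"
  have F: "K_embedding Sig le ?F (ult Sig N) (ult Sig L)"
    and G: "K_embedding Sig le ?G (ult Sig N') (ult Sig L)"
    by (intro ult_K_embedding ev)+
  have FG: "?F x = ?G x" if x: "x \<in> univ M" for x
  proof -
    have "eventually (\<lambda>i. f i x = g i x) U"
      using ev(7) mem[OF x] by eventually_elim blast
    then have "?F (cls (\<lambda>_. x)) = ?G (cls (\<lambda>_. x))"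
      by (simp add: ult_map_cls cls_eq_iff)
    then show ?thesis
      by (simp add: const[OF x])
  qed
  have "?F (cls b) = ?G (cls c)"
    using ev(8) by (simp add: ult_map_cls cls_eq_iff)
  have MN: "(M, ult Sig N) \<in> le"
    using M by (simp add: N_def[abs_def])
  have "(M, ult Sig N') \<in> le"
  proof -
    obtain L1 where L1: "struct_iso Sig ?F (ult Sig N) L1" "(L1, ult Sig L) \<in> le"
      using F by (auto simp: K_embedding_def)
    obtain L2 where L2: "struct_iso Sig ?G (ult Sig N') L2" "(L2, ult Sig L) \<in> le"
      using G by (auto simp: K_embedding_def)
    obtain M' where M': "struct_iso Sig ?F M M'" "substruct Sig M' L1" "univ M' = ?F ` univ M"
      by (rule struct_iso_image[OF L1(1) le_substruct[OF MN]])
    have "(M', ult Sig L) \<in> le"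
      by (rule le_trans[OF iso_le[OF MN L1(1) M'(1)] L1(2)])
    have "eventually (\<lambda>i. substruct Sig (B i) M \<and> substruct Sig (B i) (N' i)) U"
      using sub ev(2) by eventually_elim (simp add: le_substruct)
    then have MN': "substruct Sig M (ult Sig N')"
      using K_struct[OF le_K(1)[OF MN]] const mem by (intro substruct_of_ult[where A = B])
    have M'_G: "univ M' = ?G ` univ M"
      using M'(3) FG by simp
    have G_bij: "bij_betw ?G (univ (ult Sig N')) (univ L2)"
      using L2(1) by (simp add: struct_iso_def)
    have "univ M' \<subseteq> univ L2"
      using G_bij substruct_subset[OF MN'] M'_G by (auto simp: bij_betw_def)
    then have M'_L2: "(M', L2) \<in> le"
      using coherence[OF \<open>(M', ult Sig L) \<in> le\<close> L2(2)] by blast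
    have "inv_into (univ (ult Sig N')) ?G ` univ M' = univ M"
      unfolding M'_G using G_bij substruct_subset[OF MN']
      by (intro inv_into_image_cancel) (auto simp: bij_betw_def)
    then have "struct_iso Sig (inv_into (univ (ult Sig N')) ?G) M' M"
      by (rule struct_iso_restrict[OF struct_iso_inv[OF L2(1)] le_substruct[OF M'_L2] MN'])
    then show ?thesis
      by (rule iso_le[OF M'_L2 struct_iso_inv[OF L2(1)]])
  qed
  moreover have "cls b \<in> univ (ult Sig N)" "cls c \<in> univ (ult Sig N')"
    using ev(1,3) by (simp_all add: cls_in_classes)
  moreover have "ult Sig L \<in> K"
    by (rule ult_directed(1)[OF ev(4)])
  ultimately have "((cls b, M, ult Sig N), (cls c, M, ult Sig N')) \<in> atomic_equiv Sig K le M"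
    using MN F G FG \<open>?F (cls b) = ?G (cls c)\<close> unfolding atomic_equiv_iff triples_over_def by blast
  then show ?thesis
    unfolding b_def c_def N_def N'_def .
qed

text \<open>
  In the induction, the last link is split off at all indices at once; this is why the chains must
  have the same length almost everywhere.
\<close>

lemma relpow_atomic_equiv_ult:
  assumes M: "(M, ult Sig (\<lambda>i. snd (snd (s i)))) \<in> le"
    and const: "\<And>x. x \<in> univ M \<Longrightarrow> cls (\<lambda>_. x) = x"
    and sub: "eventually (\<lambda>i. substruct Sig (B i) M) U"
    and mem: "\<And>x. x \<in> univ M \<Longrightarrow> eventually (\<lambda>i. x \<in> univ (B i)) U"
    and st: "eventually (\<lambda>i. (s i, t i) \<in> atomic_equiv Sig K le (B i) ^^ Suc n) U"
  shows "((cls (\<lambda>i. fst (s i)), M, ult Sig (\<lambda>i. snd (snd (s i)))),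
      (cls (\<lambda>i. fst (t i)), M, ult Sig (\<lambda>i. snd (snd (t i))))) \<in> (atomic_equiv Sig K le M)\<^sup>+"
  using st
proof (induction n arbitrary: t)
  case 0
  then show ?case
    by (intro r_into_trancl atomic_equiv_ult[OF M const sub mem]) simp_all
next
  case (Suc n)
  have "\<forall>i. \<exists>u. (s i, t i) \<in> atomic_equiv Sig K le (B i) ^^ Suc (Suc n) \<longrightarrow>
      (s i, u) \<in> atomic_equiv Sig K le (B i) ^^ Suc n \<and> (u, t i) \<in> atomic_equiv Sig K le (B i)"
    by (meson relpow_Suc_E)
  then obtain u where u: "\<And>i. (s i, t i) \<in> atomic_equiv Sig K le (B i) ^^ Suc (Suc n) \<Longrightarrow>
      (s i, u i) \<in> atomic_equiv Sig K le (B i) ^^ Suc n \<and> (u i, t i) \<in> atomic_equiv Sig K le (B i)"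
    by metis
  have su: "eventually (\<lambda>i. (s i, u i) \<in> atomic_equiv Sig K le (B i) ^^ Suc n) U"
    and ut: "eventually (\<lambda>i. (u i, t i) \<in> atomic_equiv Sig K le (B i)) U"
    using Suc.prems by (eventually_elim, use u in blast)+
  note su' = Suc.IH[OF su]
  have "(atomic_equiv Sig K le M)\<^sup>+ \<subseteq> triples_over le M \<times> triples_over le M"
    by (rule trancl_subset_Sigma) (auto simp: atomic_equiv_def)
  then have "(M, ult Sig (\<lambda>i. snd (snd (u i)))) \<in> le"
    using su' by (auto simp: triples_over_def)
  from atomic_equiv_ult[OF this const sub mem ut] su' show ?case
    by (rule trancl_into_trancl[rotated])
qed

end


section \<open>Tameness\<close>

text \<open>
  The filter is generated by the cones \<open>{i \<in> I. X \<subseteq> i}\<close> with \<open>X\<close> of size at most \<open>\<kappa>\<close>. Because a union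
  of fewer than \<open>\<kappa>\<close> such \<open>X\<close> has size at most \<open>\<kappa>\<close> again, it is \<open>\<kappa>\<close>-complete for singular \<open>\<kappa>\<close>
  too.
\<close>

lemma cone_filter:
  fixes I V :: "'v::zfc_universe set" and \<kappa> :: "'v rel"
  assumes \<kappa>: "Card_order \<kappa>" "infinite (Field \<kappa>)"
    and cover: "\<And>X. X \<subseteq> V \<Longrightarrow> |X| \<le>o \<kappa> \<Longrightarrow> \<exists>i\<in>I. X \<subseteq> elts i"
  obtains F where "F \<le> principal I" "F \<noteq> bot" "complete_filter \<kappa> F"
    "\<forall>x\<in>V. eventually (\<lambda>i. x \<in> elts i) F"
proof -
  define ev where "ev P \<longleftrightarrow> (\<exists>X\<subseteq>V. |X| \<le>o \<kappa> \<and> (\<forall>i\<in>I. X \<subseteq> elts i \<longrightarrow> P i))" for P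
  have finite_le: "|X| \<le>o \<kappa>" if "finite X" for X :: "'v set"
  proof -
    have "|X| <o \<kappa>"
      using finite_ordLess_infinite[OF card_of_Well_order[of X], of \<kappa>] that \<kappa>
      by (simp add: Field_card_of card_order_on_def)
    then show ?thesis
      by (rule ordLess_imp_ordLeq)
  qed
  have fil: "is_filter ev"
  proof
    show "ev (\<lambda>_. True)"
      unfolding ev_def using finite_le[of "{}"] by auto
    show "ev (\<lambda>i. P i \<and> Q i)" if PQ: "ev P" "ev Q" for P Q
    proof -
      obtain X where X: "X \<subseteq> V" "|X| \<le>o \<kappa>" "\<forall>i\<in>I. X \<subseteq> elts i \<longrightarrow> P i"
        using PQ(1) by (auto simp: ev_def)
      obtain Y where Y: "Y \<subseteq> V" "|Y| \<le>o \<kappa>" "\<forall>i\<in>I. Y \<subseteq> elts i \<longrightarrow> Q i"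
        using PQ(2) by (auto simp: ev_def)
      have "|X \<union> Y| \<le>o \<kappa>"
        using \<kappa> X Y by (intro card_of_Un_ordLeq_infinite_Field)
      then show ?thesis
        unfolding ev_def using X Y by (intro exI[of _ "X \<union> Y"]) simp
    qed
    show "ev Q" if "\<forall>i. P i \<longrightarrow> Q i" "ev P" for P Q
      using that unfolding ev_def by blast
  qed
  define F where "F = Abs_filter ev"
  have F: "eventually P F \<longleftrightarrow> ev P" for P
    unfolding F_def by (rule eventually_Abs_filter[OF fil])
  show thesis
  proof
    show "F \<le> principal I"
      unfolding le_principal F ev_def using finite_le[of "{}"] by auto
    have "\<not> ev (\<lambda>_. False)"
      unfolding ev_def using cover by blast
    then show "F \<noteq> bot"
      using F[of "\<lambda>_. False"] by auto
    show "\<forall>x\<in>V. eventually (\<lambda>i. x \<in> elts i) F"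
    proof
      fix x assume "x \<in> V"
      then show "eventually (\<lambda>i. x \<in> elts i) F"
        unfolding F ev_def using finite_le[of "{x}"] by (intro exI[of _ "{x}"]) simp
    qed
    show "complete_filter \<kappa> F"
      unfolding complete_filter_def
    proof (intro allI impI)
      fix S :: "'v set set" assume S: "|S| <o \<kappa>" and SF: "\<forall>A\<in>S. eventually (\<lambda>x. x \<in> A) F"
      have "\<forall>A\<in>S. \<exists>X\<subseteq>V. |X| \<le>o \<kappa> \<and> (\<forall>i\<in>I. X \<subseteq> elts i \<longrightarrow> i \<in> A)"
        using SF by (simp only: F ev_def)
      then obtain X where X: "\<And>A. A \<in> S \<Longrightarrow> X A \<subseteq> V \<and> |X A| \<le>o \<kappa> \<and> (\<forall>i\<in>I. X A \<subseteq> elts i \<longrightarrow> i \<in> A)"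
        by metis
      have "|\<Union>A\<in>S. X A| \<le>o \<kappa>"
        by (rule card_of_UNION_ordLeq_infinite_Field[OF \<kappa>(2,1) ordLess_imp_ordLeq[OF S]])
          (use X in blast)
      moreover have "(\<Union>A\<in>S. X A) \<subseteq> V"
        by (rule UN_least) (use X in blast)
      moreover have "\<forall>i\<in>I. (\<Union>A\<in>S. X A) \<subseteq> elts i \<longrightarrow> i \<in> \<Inter>S"
        using X by (simp add: UN_subset_iff)
      ultimately show "eventually (\<lambda>x. x \<in> \<Inter>S) F"
        unfolding F ev_def by (intro exI[of _ "\<Union>A\<in>S. X A"] conjI)
    qed
  qed
qed

text \<open>The power set is taken inside the universe, so that the new cardinal is again a relation on it.\<close>

lemma larger_cardinal:
  fixes \<theta> :: "'v::zfc_universe rel"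
  assumes "cardinal \<theta>"
  obtains \<mu> :: "'v rel" where "cardinal \<mu>" "\<theta> <o \<mu>"
proof
  let ?T = "Field \<theta>"
  let ?P = "{z. elts z \<subseteq> ?T}"
  have T: "small ?T" "Card_order \<theta>"
    using assms by (simp_all add: cardinal_def)
  show "cardinal |?P|"
    unfolding cardinal_def Field_card_of
    by (intro conjI card_of_card_order_on small_powerset T)
  have "bij_betw elts ?P (Pow ?T)"
  proof (rule bij_betw_imageI)
    show "inj_on elts ?P"
      by (auto intro!: inj_onI extensionality)
    show "elts ` ?P = Pow ?T"
    proof (intro set_eqI iffI)
      fix X assume "X \<in> Pow ?T"
      then have "elts (vset X) = X"
        using small_subset[OF T(1)] by simp
      then show "X \<in> elts ` ?P"
        using \<open>X \<in> Pow ?T\<close> by (intro image_eqI[of _ _ "vset X"]) auto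
    qed auto
  qed
  then have "|?P| =o |Pow ?T|"
    by (rule card_of_ordIsoI)
  moreover have "\<theta> =o |?T|"
    using T(2) card_of_Field_ordIso ordIso_symmetric by blast
  ultimately show "\<theta> <o |?P|"
    using card_of_Pow[of ?T] ordIso_ordLess_trans ordLess_ordIso_trans ordIso_symmetric by blast
qed

theorem corollary3p6:
  fixes Sig :: "'v::zfc_universe signature"
    and K :: "'v struct set"
    and le :: "'v struct rel"
  assumes "\<forall>\<mu> :: 'v rel. cardinal \<mu> \<longrightarrow> (\<exists>\<kappa>. L_compact \<mu> \<kappa>)"
    and "AEC Sig K le"
  shows "tame Sig K le"
proof -
  interpret aec Sig K le
    by unfold_locales (rule assms(2))
  obtain \<mu> :: "'v rel" where \<mu>: "cardinal \<mu>" "LS Sig K le <o \<mu>"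
    by (rule larger_cardinal[OF LS_cardinal])
  then obtain \<kappa> where compact: "L_compact \<mu> \<kappa>"
    using assms(1) by blast
  have \<kappa>: "cardinal \<kappa>" "Card_order \<kappa>" and "\<mu> \<le>o \<kappa>"
    using compact by (simp_all add: L_compact_def cardinal_def)
  have LS_\<kappa>: "LS Sig K le \<le>o \<kappa>"
    using \<mu>(2) \<open>\<mu> \<le>o \<kappa>\<close> ordLess_ordLeq_trans ordLess_imp_ordLeq by blast
  have "Cinfinite (LS Sig K le)"
    using LS_infinite LS_cardinal by (simp add: cinfinite_def cardinal_def)
  then have \<kappa>_inf: "infinite (Field \<kappa>)"
    using cinfinite_mono[OF LS_\<kappa>] by (simp add: cinfinite_def)
  have "p = q"
    if "M \<in> K" and p: "p \<in> galois_types Sig K le M" and q: "q \<in> galois_types Sig K le M"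
      and same: "\<forall>M0. (M0, M) \<in> le \<longrightarrow> |univ M0| \<le>o \<kappa> \<longrightarrow>
        restrict_type Sig K le p M0 = restrict_type Sig K le q M0" for M p q
  proof -
    note equiv = equiv_atomic_equiv_trancl[OF AEC]
    obtain a1 N1 where p_def: "p = galois_type Sig K le a1 M N1" and N1: "(M, N1) \<in> le" "a1 \<in> univ N1"
      using p by (auto simp: galois_types_def galois_type_def triples_over_def elim!: quotientE)
    obtain a2 N2 where q_def: "q = galois_type Sig K le a2 M N2" and N2: "(M, N2) \<in> le" "a2 \<in> univ N2"
      using q by (auto simp: galois_types_def galois_type_def triples_over_def elim!: quotientE)
    have local: "((a1, M0, N1), (a2, M0, N2)) \<in> (atomic_equiv Sig K le M0)\<^sup>+"
      if M0: "(M0, M) \<in> le" "|univ M0| \<le>o \<kappa>" for M0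
    proof -
      have "galois_type Sig K le a1 M0 N1 = galois_type Sig K le a2 M0 N2"
        using same M0 restrict_galois_type[OF AEC M0(1) N1] restrict_galois_type[OF AEC M0(1) N2]
        by (simp add: p_def q_def)
      moreover have "(a2, M0, N2) \<in> triples_over le M0"
        using le_trans[OF M0(1) N2(1)] N2(2) by (simp add: triples_over_def)
      ultimately show ?thesis
        unfolding galois_type_def by (rule eq_equiv_class[OF _ equiv])
    qed
    \<comment> \<open>A strong substructure of \<open>M\<close> is coded by the set of its elements.\<close>
    define B where "B i = restr Sig M (elts i)" for i
    define I where "I = {i. elts i \<subseteq> univ M \<and> |elts i| \<le>o \<kappa> \<and> (B i, M) \<in> le}"
    have M_struct: "small (univ M)"
      using K_struct[OF \<open>M \<in> K\<close>] by (simp add: struct_on_def)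
    have I: "small I"
      by (rule small_subset[OF small_powerset[OF M_struct]]) (auto simp: I_def)
    have cover: "\<exists>i\<in>I. X \<subseteq> elts i" if X: "X \<subseteq> univ M" "|X| \<le>o \<kappa>" for X
    proof -
      obtain N where N: "(N, M) \<in> le" "X \<subseteq> univ N" "|univ N| \<le>o \<kappa>"
        by (rule LS_down[OF \<open>M \<in> K\<close> X LS_\<kappa> \<kappa>(2)])
      have "elts (vset (univ N)) = univ N"
        by (rule elts_vset[OF small_subset[OF M_struct le_subset[OF N(1)]]])
      moreover have "N = restr Sig M (univ N)"
        by (rule substruct_eq_restr[OF le_substruct[OF N(1)]])
      ultimately have "vset (univ N) \<in> I"
        using N le_subset[OF N(1)] by (simp add: I_def B_def)
      then show ?thesis
        using \<open>elts (vset (univ N)) = univ N\<close> N(2) by auto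
    qed
    obtain F where F: "F \<le> principal I" "F \<noteq> bot" "complete_filter \<kappa> F"
      and F_mem: "\<forall>x\<in>univ M. eventually (\<lambda>i. x \<in> elts i) F"
      by (rule cone_filter[OF \<kappa>(2) \<kappa>_inf cover])
    obtain U where U: "U \<le> F" "ultrafilter U" "complete_filter \<mu> U"
      using compact I F unfolding L_compact_def by blast
    have U_I: "U \<le> principal I" "U \<noteq> bot"
      using U F(1) by (auto simp: ultrafilter_def)
    have "small (univ N1 \<union> univ N2)"
      using K_struct[OF le_K(2)[OF N1(1)]] K_struct[OF le_K(2)[OF N2(1)]]
      by (intro small_Un) (simp_all add: struct_on_def)
    then obtain cls :: "('v \<Rightarrow> 'v) \<Rightarrow> 'v" where
      cls: "\<And>g h. cls g = cls h \<longleftrightarrow> eventually (\<lambda>i. g i = h i) U"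
        "\<And>X. (\<And>i. small (X i)) \<Longrightarrow> small {cls g | g. eventually (\<lambda>i. g i \<in> X i) U}"
      and const: "\<And>x. x \<in> univ N1 \<union> univ N2 \<Longrightarrow> cls (\<lambda>_. x) = x"
      using function_classes_exist[OF I U_I(2,1)] by blast
    interpret complete_ultraproduct Sig K le U cls \<mu>
      by unfold_locales (fact cls U \<mu>)+
    have ev_I: "eventually (\<lambda>i. i \<in> I) U"
      using U_I(1) by (simp add: le_principal)
    let ?s = "\<lambda>i. (a1, B i, N1)" and ?t = "\<lambda>i. (a2, B i, N2)"
    \<comment> \<open>The lengths of the chains depend on the index, but countable completeness makes one length
      occur almost everywhere.\<close>
    have "eventually (\<lambda>i. \<exists>n\<in>UNIV. (?s i, ?t i) \<in> atomic_equiv Sig K le (B i) ^^ Suc n) U"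
      using ev_I
    proof eventually_elim
      case (elim i)
      then have "(?s i, ?t i) \<in> (atomic_equiv Sig K le (B i))\<^sup>+"
        by (intro local) (auto simp: I_def B_def)
      then show ?case
        by (auto simp: trancl_power gr0_conv_Suc)
    qed
    moreover have "|UNIV :: nat set| \<le>o |T|"
      using LS_infinite by (simp add: infinite_iff_card_of_nat)
    ultimately obtain n where
      n: "eventually (\<lambda>i. (?s i, ?t i) \<in> atomic_equiv Sig K le (B i) ^^ Suc n) U"
      using ev_Bex[of UNIV "\<lambda>n i. (?s i, ?t i) \<in> atomic_equiv Sig K le (B i) ^^ Suc n"] by blast
    have B_sub: "eventually (\<lambda>i. substruct Sig (B i) M) U"
      using ev_I by (rule eventually_mono) (simp add: I_def le_substruct)
    have B_mem: "eventually (\<lambda>i. x \<in> univ (B i)) U" if "x \<in> univ M" for x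
      using filter_leD[OF U(1) F_mem[THEN bspec, OF that]] by (simp add: B_def)
    have const_M: "cls (\<lambda>_. x) = x" if "x \<in> univ M" for x
      using const le_subset[OF N1(1)] that by blast
    have "(M, ult Sig (\<lambda>_. N1)) \<in> le"
      using le_trans[OF N1(1) le_ultrapower[OF le_K(2)[OF N1(1)]]] const by blast
    then have "((a1, M, ult Sig (\<lambda>_. N1)), (a2, M, ult Sig (\<lambda>_. N2))) \<in> (atomic_equiv Sig K le M)\<^sup>+"
      using relpow_atomic_equiv_ult[of M ?s B ?t n, OF _ const_M B_sub B_mem n] N1(2) N2(2) const
      by simp
    moreover have "((a1, M, N1), (a1, M, ult Sig (\<lambda>_. N1))) \<in> (atomic_equiv Sig K le M)\<^sup>+"
      by (intro r_into_trancl atomic_equiv_ultrapower N1 const) simp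
    moreover have "((a2, M, N2), (a2, M, ult Sig (\<lambda>_. N2))) \<in> (atomic_equiv Sig K le M)\<^sup>+"
      by (intro r_into_trancl atomic_equiv_ultrapower N2 const) simp
    then have "((a2, M, ult Sig (\<lambda>_. N2)), (a2, M, N2)) \<in> (atomic_equiv Sig K le M)\<^sup>+"
      using equiv[of M] by (auto simp: equiv_def dest: symD)
    ultimately have "((a1, M, N1), (a2, M, N2)) \<in> (atomic_equiv Sig K le M)\<^sup>+"
      by (meson trancl_trans)
    then show "p = q"
      unfolding p_def q_def galois_type_def by (rule equiv_class_eq[OF equiv])
  qed
  then show ?thesis
    unfolding tame_def using \<kappa>(1) LS_\<kappa> by blast
qed

end
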